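(* Suppose that the datapoints $(Z_i)_{i\ge1}$ are i.i.d. copies of a random element $Z_0$. Then, for each $n$, $$\operatorname{Var}\Big(\frac{1}{\sqrt n}\sum_{j=1}^k\sum_{i\in B_j'}\big(h_n'(Z_i,Z_{B_j})-\mathbb E[h_n'(Z_i,Z_{B_j})\mid Z_i]\big)\Big)\le \frac32\, n\Big(1-\frac1k\Big)\gamma_{loss}(h_n).$$ Hence, with $\bar h_n(z)=\mathbb E[h_n(z,Z_{1:n(1-1/k)})]$ and $\sigma_n^2=\operatorname{Var}(\bar h_n(Z_0))\in(0,\infty)$, if $\gamma_{loss}(h_n)=o(\sigma_n^2/n)$ as $n\to\infty$, then $$\frac{1}{\sigma_n\sqrt n}\sum_{j=1}^k\sum_{i\in B_j'}\Big(h_n(Z_i,Z_{B_j})-\mathbb E[h_n(Z_i,Z_{B_j})\mid Z_{B_j}]-\big(\bar h_n(Z_i)-\mathbb E[\bar h_n(Z_i)]\big)\Big)\to 0\quad\text{in } L^2.$$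
   Context: $(Z_i)_{i\ge1}$ is a sequence of random elements of a (measurable) set $\mathcal Z$. For each sample size $n$, $k=k_n\ge 2$ is a number of folds, possibly depending on $n$, which divides $n$ evenly, and $\{(B_j,B_j')\}_{j=1}^k$ are (non-random) train-validation splits: $B_j$ and $B_j'$ are vectors of distinct indices in $[n]=\{1,\dots,n\}$ which together partition $[n]$, and the validation index vectors $B_1',\dots,B_k'$ partition $[n]$ into $k$ folds of size $n/k$; each $B_j$ has length $m=n(1-1/k)$. For a vector $B$ of indices, $Z_B$ is the subvector of $Z_{1:n}=(Z_1,\dots,Z_n)$ with the ordered indices in $B$. $h_n:\mathcal Z\times\mathcal Z^m\to\mathbb R$ is a (measurable) loss function (not assumed symmetric in the training points), and all expectations that appear are assumed to be well defined. For $h:\mathcal Z\times\mathcal Z^m\to\mathbb R$ and i.i.d. $Z_0,Z_0',Z_1,\dots,Z_m$, let $Z_{1:m}^{\backslash i}$ be $Z_{1:m}$ with $Z_i$ replaced by $Z_0'$. The mean-square stability is $\gamma_{ms}(h)=\frac1m\sum_{i=1}^m\mathbb E[(h(Z_0,Z_{1:m})-h(Z_0,Z_{1:m}^{\backslash i}))^2]$, and the loss stability is $\gamma_{loss}(h)=\gamma_{ms}(h')$, where $h'(Z_0,Z_{1:m})=h(Z_0,Z_{1:m})-\mathbb E[h(Z_0,Z_{1:m})\mid Z_{1:m}]$. $h_n'$ denotes the function obtained from $h_n$ in this way (so $h_n'(z,D)=h_n(z,D)-\mathbb E[h_n(Z_0,D)]$ for fixed $D$). *)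

theory Defs
  imports "HOL-Probability.Probability" "HOL-Library.Landau_Symbols"
begin

text \<open>
  A vector in the m-fold power of a measurable space is an extensional function on the
  positions \<^term>\<open>{..<m}\<close>, i.e. a point of the product space below.  The training points
  numbered 1, ..., m thus sit at the positions 0, ..., m - 1.
\<close>

abbreviation vecs :: "'z measure \<Rightarrow> nat \<Rightarrow> (nat \<Rightarrow> 'z) measure"
  where "vecs N m \<equiv> PiM {..<m} (\<lambda>_. N)"

definition subvec :: "(nat \<Rightarrow> 'a \<Rightarrow> 'z) \<Rightarrow> nat list \<Rightarrow> 'a \<Rightarrow> nat \<Rightarrow> 'z"
  where "subvec Z B \<omega> = (\<lambda>l\<in>{..<length B}. Z (B ! l) \<omega>)"

definition train_size :: "nat \<Rightarrow> nat \<Rightarrow> nat"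
  where "train_size n k = n - n div k"

lemma real_train_size:
  assumes "k dvd n"
  shows "real (train_size n k) = real n * (1 - 1 / real k)"
  using assms by (simp add: train_size_def of_nat_diff real_of_nat_div algebra_simps)

definition kfold_splits ::
    "nat \<Rightarrow> nat \<Rightarrow> (nat \<Rightarrow> nat list) \<Rightarrow> (nat \<Rightarrow> nat list) \<Rightarrow> bool"
  where "kfold_splits n k B B' \<longleftrightarrow>
    1 \<le> n \<and> 2 \<le> k \<and> k dvd n \<and>
    (\<forall>j\<in>{1..k}.
        distinct (B j) \<and> distinct (B' j) \<and>
        set (B j) \<union> set (B' j) = {1..n} \<and> set (B j) \<inter> set (B' j) = {} \<and>
        length (B j) = train_size n k \<and> length (B' j) = n div k) \<and>
    (\<Union>j\<in>{1..k}. set (B' j)) = {1..n} \<and>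
    disjoint_family_on (\<lambda>j. set (B' j)) {1..k}"

text \<open>
  Second moments take values in \<^typ>\<open>ennreal\<close>, so that an infinite variance or stability is not
  conflated with the value 0 of the Bochner integral of a non-integrable function.
\<close>

definition evar :: "'a measure \<Rightarrow> ('a \<Rightarrow> real) \<Rightarrow> ennreal"
  where "evar M X = (\<integral>\<^sup>+\<omega>. ennreal ((X \<omega> - (\<integral>\<omega>'. X \<omega>' \<partial>M))\<^sup>2) \<partial>M)"

lemma (in prob_space) evar_eq_variance:
  assumes "X \<in> borel_measurable M" "integrable M (\<lambda>\<omega>. (X \<omega>)\<^sup>2)"
  shows "evar M X = ennreal (variance X)"
proof -
  have "integrable M X"
    using assms by (rule square_integrable_imp_integrable)
  then have "integrable M (\<lambda>\<omega>. (X \<omega> - expectation X)\<^sup>2)"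
    using assms(2) by (simp add: power2_diff)
  then show ?thesis
    unfolding evar_def by (intro nn_integral_eq_integral) auto
qed

text \<open>The conditional expectation of \<open>f\<close> given the random element \<open>X\<close> of \<open>N\<close>.\<close>

definition cond_exp_given ::
    "'a measure \<Rightarrow> 'b measure \<Rightarrow> ('a \<Rightarrow> 'b) \<Rightarrow> ('a \<Rightarrow> real) \<Rightarrow> 'a \<Rightarrow> real"
  where "cond_exp_given M N X f = real_cond_exp M (vimage_algebra (space M) X N) f"

text \<open>
  In the next three definitions \<open>P\<close> is the common law of the i.i.d. points; the product measure
  is the joint law of \<open>Z\<^sub>0\<close>, \<open>Z\<^sub>0'\<close> and the training vector, and \<open>D(i := z')\<close> is the
  training vector with one point replaced.
\<close>

definition ms_stability :: "'z measure \<Rightarrow> nat \<Rightarrow> ('z \<Rightarrow> (nat \<Rightarrow> 'z) \<Rightarrow> real) \<Rightarrow> ennreal"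
  where "ms_stability P m h =
    (\<Sum>i<m. \<integral>\<^sup>+(z, z', D). ennreal ((h z D - h z (D(i := z')))\<^sup>2)
        \<partial>(P \<Otimes>\<^sub>M P \<Otimes>\<^sub>M vecs P m)) / of_nat m"

definition centered_loss ::
    "'z measure \<Rightarrow> ('z \<Rightarrow> (nat \<Rightarrow> 'z) \<Rightarrow> real) \<Rightarrow> 'z \<Rightarrow> (nat \<Rightarrow> 'z) \<Rightarrow> real"
  where "centered_loss P h z D = h z D - (\<integral>z\<^sub>0. h z\<^sub>0 D \<partial>P)"

definition loss_stability :: "'z measure \<Rightarrow> nat \<Rightarrow> ('z \<Rightarrow> (nat \<Rightarrow> 'z) \<Rightarrow> real) \<Rightarrow> ennreal"
  where "loss_stability P m h = ms_stability P m (centered_loss P h)"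

definition mean_loss ::
    "'a measure \<Rightarrow> (nat \<Rightarrow> 'a \<Rightarrow> 'z) \<Rightarrow> nat \<Rightarrow> ('z \<Rightarrow> (nat \<Rightarrow> 'z) \<Rightarrow> real) \<Rightarrow> 'z \<Rightarrow> real"
  where "mean_loss M Z m h z = (\<integral>\<omega>. h z (subvec Z [1..<Suc m] \<omega>) \<partial>M)"

text \<open>
  The limit of large sample sizes along the set \<open>S\<close> of admissible ones.  Admissibility is
  restricted because no \<open>k \<ge> 2\<close> divides 1, and, say, a constant number of folds only divides
  some \<open>n\<close>; all \<open>n \<ge> 2\<close> is the case \<^term>\<open>S = {2::nat..}\<close>.
\<close>

abbreviation sizes_to_infinity :: "nat set \<Rightarrow> nat filter"
  where "sizes_to_infinity S \<equiv> inf sequentially (principal S)"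

end

theory Submission
  imports Defs
begin

text \<open>
  Write \<open>W\<^sub>i = \<phi>(Z\<^sub>i, Z\<^sub>B)\<close> with \<open>\<phi>(z, D) = h'(z, D) - \<integral>h'(z, D') dD'\<close>; it is centered in the
  validation point, and the quantities in both claims are multiples of \<open>\<Sum>\<^sub>i W\<^sub>i\<close> almost surely.
  By the Efron--Stein inequality \<open>E W\<^sub>i\<^sup>2 \<le> m \<gamma> / 2\<close>.  Let \<open>T\<^sub>l\<close> integrate out the \<open>l\<close>-th
  data point.  Since \<open>W\<^sub>i\<close> is centered in \<open>Z\<^sub>i\<close> and \<open>W\<^sub>l\<close> in \<open>Z\<^sub>l\<close>, for \<open>i \<noteq> l\<close>
  \<open>E (W\<^sub>i W\<^sub>l) = E ((W\<^sub>i - T\<^sub>l W\<^sub>i) (W\<^sub>l - T\<^sub>i W\<^sub>l))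
    \<le> (E (W\<^sub>i - T\<^sub>l W\<^sub>i)\<^sup>2 + E (W\<^sub>l - T\<^sub>i W\<^sub>l)\<^sup>2) / 2\<close>,
  and \<open>\<Sum>\<^sub>l E (W\<^sub>i - T\<^sub>l W\<^sub>i)\<^sup>2 = m \<gamma> / 2\<close>, so that \<open>E (\<Sum>\<^sub>i W\<^sub>i)\<^sup>2 \<le> n m \<gamma>\<close>.
  The variance inequalities hold in \<^typ>\<open>ennreal\<close> without integrability hypotheses, so
  finite stability yields square integrability of the \<open>W\<^sub>i\<close>.
\<close>

section \<open>The Efron--Stein inequality\<close>

context prob_space
begin

text \<open>Bias-variance decomposition around an arbitrary center \<open>c\<close>. If
  \<open>f\<close> is not square integrable, then neither is any translate \<open>f - d\<close>, and
  both sides are infinite.\<close>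

lemma nn_variance_shift:
  fixes f :: "'a \<Rightarrow> real"
  assumes [measurable]: "f \<in> borel_measurable M"
  shows "(\<integral>\<^sup>+x. ennreal ((f x - c)\<^sup>2) \<partial>M)
    = (\<integral>\<^sup>+x. ennreal ((f x - expectation f)\<^sup>2) \<partial>M) + ennreal ((expectation f - c)\<^sup>2)"
proof (cases "integrable M (\<lambda>x. (f x)\<^sup>2)")
  case True
  then have int: "integrable M f"
    by (rule square_integrable_imp_integrable[OF assms])
  have nn: "(\<integral>\<^sup>+x. ennreal ((f x - d)\<^sup>2) \<partial>M) = ennreal (expectation (\<lambda>x. (f x)\<^sup>2) - 2 * d * expectation f + d\<^sup>2)"
    for d
  proof -
    have "integrable M (\<lambda>x. (f x - d)\<^sup>2)"
      using True int by (simp add: power2_diff)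
    then have "(\<integral>\<^sup>+x. ennreal ((f x - d)\<^sup>2) \<partial>M) = ennreal (expectation (\<lambda>x. (f x - d)\<^sup>2))"
      by (intro nn_integral_eq_integral) auto
    also have "expectation (\<lambda>x. (f x - d)\<^sup>2) = expectation (\<lambda>x. (f x)\<^sup>2) - 2 * d * expectation f + d\<^sup>2"
      using True int by (simp add: power2_diff prob_space mult_ac)
    finally show ?thesis .
  qed
  have "0 \<le> expectation (\<lambda>x. (f x - expectation f)\<^sup>2)"
    by simp
  also have "expectation (\<lambda>x. (f x - expectation f)\<^sup>2)
      = expectation (\<lambda>x. (f x)\<^sup>2) - 2 * expectation f * expectation f + (expectation f)\<^sup>2"
    using True int by (simp add: power2_diff prob_space mult_ac)
  finally have nonneg: "0 \<le> expectation (\<lambda>x. (f x)\<^sup>2) - 2 * expectation f * expectation f + (expectation f)\<^sup>2" .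
  show ?thesis
    unfolding nn ennreal_plus[OF nonneg zero_le_power2, symmetric]
    by (intro arg_cong[where f = ennreal]) (simp add: power2_eq_square algebra_simps)
next
  case False
  have "(\<integral>\<^sup>+x. ennreal ((f x - d)\<^sup>2) \<partial>M) = \<infinity>" for d
  proof (rule ccontr)
    assume "\<not> ?thesis"
    then have sq: "integrable M (\<lambda>x. (f x - d)\<^sup>2)"
      by (intro integrableI_bounded) (auto simp: top.not_eq_extremum)
    have "integrable M (\<lambda>x. f x - d)"
      by (rule square_integrable_imp_integrable[OF _ sq]) simp
    then have "integrable M (\<lambda>x. 2 * d * (f x - d))"
      by (rule integrable_mult_right)
    from Bochner_Integration.integrable_add[OF Bochner_Integration.integrable_add[OF sq this], of "\<lambda>_. d\<^sup>2"]
    have "integrable M (\<lambda>x. (f x - d)\<^sup>2 + 2 * d * (f x - d) + d\<^sup>2)"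
      by simp
    moreover have "(\<lambda>x. (f x - d)\<^sup>2 + 2 * d * (f x - d) + d\<^sup>2) = (\<lambda>x. (f x)\<^sup>2)"
      by (simp add: fun_eq_iff power2_diff) (simp add: power2_eq_square algebra_simps)
    ultimately show False
      using False by simp
  qed
  then show ?thesis
    by simp
qed

text \<open>Take \<open>f x\<close> as the center in \<open>nn_variance_shift\<close> and integrate
  over \<open>x\<close>: an independent copy contributes the variance a second time.\<close>

lemma nn_variance_copy:
  fixes f :: "'a \<Rightarrow> real"
  assumes [measurable]: "f \<in> borel_measurable M"
  shows "(\<integral>\<^sup>+x. \<integral>\<^sup>+y. ennreal ((f x - f y)\<^sup>2) \<partial>M \<partial>M)
    = 2 * (\<integral>\<^sup>+x. ennreal ((f x - expectation f)\<^sup>2) \<partial>M)"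
proof -
  have "(\<integral>\<^sup>+y. ennreal ((f x - f y)\<^sup>2) \<partial>M)
      = (\<integral>\<^sup>+y. ennreal ((f y - expectation f)\<^sup>2) \<partial>M) + ennreal ((f x - expectation f)\<^sup>2)" for x
    using nn_variance_shift[OF assms, of "f x"] by (simp add: power2_commute)
  then have "(\<integral>\<^sup>+x. \<integral>\<^sup>+y. ennreal ((f x - f y)\<^sup>2) \<partial>M \<partial>M)
      = (\<integral>\<^sup>+x. (\<integral>\<^sup>+y. ennreal ((f y - expectation f)\<^sup>2) \<partial>M) + ennreal ((f x - expectation f)\<^sup>2) \<partial>M)"
    by (rule nn_integral_cong)
  also have "\<dots> = (\<integral>\<^sup>+x. (\<integral>\<^sup>+y. ennreal ((f y - expectation f)\<^sup>2) \<partial>M) \<partial>M)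
      + (\<integral>\<^sup>+x. ennreal ((f x - expectation f)\<^sup>2) \<partial>M)"
    by (rule nn_integral_add) auto
  also have "\<dots> = 2 * (\<integral>\<^sup>+x. ennreal ((f x - expectation f)\<^sup>2) \<partial>M)"
    by (simp add: emeasure_space_1 mult_2)
  finally show ?thesis .
qed

text \<open>\<open>nn_variance_shift\<close> with center 0, the variance term being dropped.\<close>

lemma nn_Jensen_square:
  fixes f :: "'a \<Rightarrow> real"
  assumes "f \<in> borel_measurable M"
  shows "ennreal ((expectation f)\<^sup>2) \<le> (\<integral>\<^sup>+x. ennreal ((f x)\<^sup>2) \<partial>M)"
  using nn_variance_shift[OF assms, of 0] by simp

text \<open>If exactly one of the two functions is integrable, the right-hand side is infinite.\<close>

lemma nn_Jensen_square_diff: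
  fixes f g :: "'a \<Rightarrow> real"
  assumes [measurable]: "f \<in> borel_measurable M" "g \<in> borel_measurable M"
  shows "ennreal ((expectation f - expectation g)\<^sup>2) \<le> (\<integral>\<^sup>+x. ennreal ((f x - g x)\<^sup>2) \<partial>M)"
proof (cases "integrable M (\<lambda>x. (f x - g x)\<^sup>2)")
  case True
  then have *: "integrable M (\<lambda>x. f x - g x)"
    by (rule square_integrable_imp_integrable[rotated]) simp
  have iff: "integrable M f \<longleftrightarrow> integrable M g"
  proof
    assume "integrable M f"
    from Bochner_Integration.integrable_diff[OF this *] show "integrable M g" by simp
  next
    assume "integrable M g"
    from Bochner_Integration.integrable_add[OF this *] show "integrable M f" by simp
  qed
  show ?thesis
  proof (cases "integrable M f")
    case True
    then have "expectation f - expectation g = expectation (\<lambda>x. f x - g x)"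
      using iff by simp
    then show ?thesis
      using nn_Jensen_square[of "\<lambda>x. f x - g x"] by simp
  next
    case False
    \<comment> \<open>Neither integral exists, so both take the default value 0 and the left-hand
      side vanishes.\<close>
    then show ?thesis
      using iff by (simp add: not_integrable_integral_eq)
  qed
next
  case False
  have "(\<integral>\<^sup>+x. ennreal ((f x - g x)\<^sup>2) \<partial>M) = \<infinity>"
  proof (rule ccontr)
    assume "\<not> ?thesis"
    then have "integrable M (\<lambda>x. (f x - g x)\<^sup>2)"
      by (intro integrableI_bounded) (auto simp: top.not_eq_extremum)
    with False show False ..
  qed
  then show ?thesis by simp
qed

end

section \<open>Averaging out and resampling one coordinate\<close>

definition coord_mean :: "'z measure \<Rightarrow> 'i \<Rightarrow> (('i \<Rightarrow> 'z) \<Rightarrow> real) \<Rightarrow> ('i \<Rightarrow> 'z) \<Rightarrow> real"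
  where "coord_mean P l f x = (\<integral>z. f (x(l := z)) \<partial>P)"

text \<open>Applied to the loss at a fixed validation point, this is the squared effect of replacing
  training position \<open>l\<close>, which mean-square stability averages.
  \<open>coord_mean\<close> is the operator \<open>T_l\<close> of the proof idea, a pointwise
  version of the conditional expectation given the other coordinates.\<close>

definition coord_influence :: "'z measure \<Rightarrow> 'i set \<Rightarrow> 'i \<Rightarrow> (('i \<Rightarrow> 'z) \<Rightarrow> real) \<Rightarrow> ennreal"
  where "coord_influence P J l f
    = (\<integral>\<^sup>+x. \<integral>\<^sup>+z. ennreal ((f x - f (x(l := z)))\<^sup>2) \<partial>P \<partial>(\<Pi>\<^sub>M i\<in>J. P))"

locale iid_coords = prob_space P for P :: "'z measure" +
  fixes J :: "'i set"
  assumes finite_J [simp]: "finite J"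
begin

abbreviation "Q \<equiv> \<Pi>\<^sub>M i\<in>J. P"

sublocale product_sigma_finite "\<lambda>_::'i. P" ..

sublocale Q: prob_space Q
  by (intro prob_space_PiM prob_space_axioms)

sublocale QP: pair_prob_space Q P ..

lemma measurable_coord_upd:
  assumes "l \<in> J"
  shows "(\<lambda>(x, z). x(l := z)) \<in> measurable (Q \<Otimes>\<^sub>M P) Q"
proof -
  have "(\<lambda>p. (fst p)(l := snd p)) \<in> measurable (Q \<Otimes>\<^sub>M P) Q"
    by (rule measurable_fun_upd[where J = J]) (use assms in auto)
  then show ?thesis by (simp add: case_prod_beta')
qed

lemma space_upd: "l \<in> J \<Longrightarrow> x \<in> space Q \<Longrightarrow> z \<in> space P \<Longrightarrow> x(l := z) \<in> space Q"
  by (auto simp: space_PiM PiE_iff extensional_def)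

lemma measurable_upd_pair:
  assumes "l \<in> J" "f \<in> measurable Q A"
  shows "(\<lambda>(x, z). f (x(l := z))) \<in> measurable (Q \<Otimes>\<^sub>M P) A"
  using measurable_compose[OF measurable_coord_upd[OF assms(1)] assms(2)]
  by (simp add: case_prod_beta')

lemma measurable_upd_snd:
  assumes "l \<in> J" "f \<in> measurable Q A" "x \<in> space Q"
  shows "(\<lambda>z. f (x(l := z))) \<in> measurable P A"
  using measurable_Pair2[OF measurable_upd_pair[OF assms(1,2)] assms(3)] by simp

lemma measurable_coord_mean [measurable]:
  assumes "l \<in> J" "f \<in> borel_measurable Q"
  shows "coord_mean P l f \<in> borel_measurable Q"
proof -
  have "(\<lambda>x. \<integral>z. (\<lambda>(x, z). f (x(l := z))) (x, z) \<partial>P) \<in> borel_measurable Q"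
    using measurable_upd_pair[OF assms] by (intro borel_measurable_lebesgue_integral) auto
  then show ?thesis by (simp add: coord_mean_def[abs_def])
qed

lemma nn_integral_split:
  assumes "l \<in> J" "f \<in> borel_measurable Q"
  shows "(\<integral>\<^sup>+x. f x \<partial>Q) = (\<integral>\<^sup>+x. \<integral>\<^sup>+y. f (x(l := y)) \<partial>P \<partial>(\<Pi>\<^sub>M i\<in>J - {l}. P))"
proof -
  have J: "insert l (J - {l}) = J" using assms by auto
  show ?thesis
    using assms(2) by (intro product_nn_integral_insert[of "J - {l}" l f, unfolded J]) auto
qed

lemma integral_split:
  fixes f :: "('i \<Rightarrow> 'z) \<Rightarrow> real"
  assumes "l \<in> J" "integrable Q f"
  shows "(\<integral>x. f x \<partial>Q) = (\<integral>x. \<integral>y. f (x(l := y)) \<partial>P \<partial>(\<Pi>\<^sub>M i\<in>J - {l}. P))"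
proof -
  have J: "insert l (J - {l}) = J" using assms by auto
  show ?thesis
    using assms(2) by (intro product_integral_insert[of "J - {l}" l f, unfolded J]) auto
qed

text \<open>Once coordinate \<open>l\<close> is split off, the fresh value overwrites the old one,
  whose integral is then over a constant: the resampled vector has the law of the original.\<close>

lemma nn_integral_resample:
  assumes "l \<in> J" "f \<in> borel_measurable Q"
  shows "(\<integral>\<^sup>+x. \<integral>\<^sup>+z. f (x(l := z)) \<partial>P \<partial>Q) = (\<integral>\<^sup>+x. f x \<partial>Q)"
proof -
  have "(\<lambda>x. \<integral>\<^sup>+z. f (x(l := z)) \<partial>P) \<in> borel_measurable Q"
    using measurable_upd_pair[OF assms] by (intro borel_measurable_nn_integral) auto
  from nn_integral_split[OF assms(1) this] show ?thesis
    unfolding nn_integral_split[OF assms] by (simp add: emeasure_space_1)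
qed

text \<open>Given the other coordinates, \<open>f\<close> is a function of one random point with
  mean \<open>coord_mean P l f\<close>, and \<open>nn_variance_copy\<close> applies to it.\<close>

lemma two_nn_integral_coord_mean:
  assumes "l \<in> J" and [measurable]: "f \<in> borel_measurable Q"
  shows "2 * (\<integral>\<^sup>+x. ennreal ((f x - coord_mean P l f x)\<^sup>2) \<partial>Q) = coord_influence P J l f"
proof -
  have m1: "(\<lambda>x. \<integral>\<^sup>+z. ennreal ((f x - f (x(l := z)))\<^sup>2) \<partial>P) \<in> borel_measurable Q"
    using measurable_upd_pair[OF assms] by (intro borel_measurable_nn_integral) (auto simp: case_prod_beta')
  have m2: "(\<lambda>x. ennreal ((f x - coord_mean P l f x)\<^sup>2)) \<in> borel_measurable Q"
    using assms by measurable
  have "coord_influence P J l f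
      = (\<integral>\<^sup>+x. \<integral>\<^sup>+y. \<integral>\<^sup>+z. ennreal ((f (x(l := y)) - f (x(l := z)))\<^sup>2) \<partial>P \<partial>P \<partial>(\<Pi>\<^sub>M i\<in>J - {l}. P))"
    unfolding coord_influence_def
    unfolding nn_integral_split[OF \<open>l \<in> J\<close> m1] by simp
  also have "\<dots> = (\<integral>\<^sup>+x. 2 * (\<integral>\<^sup>+y. ennreal ((f (x(l := y)) - coord_mean P l f x)\<^sup>2) \<partial>P) \<partial>(\<Pi>\<^sub>M i\<in>J - {l}. P))"
  proof (rule nn_integral_cong)
    fix x assume x: "x \<in> space (\<Pi>\<^sub>M i\<in>J - {l}. P)"
    \<comment> \<open>\<open>x\<close> carries no value in coordinate \<open>l\<close>. Any point
      completes it to an element of \<open>space Q\<close>, where sections of \<open>f\<close> are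
      measurable, and the section does not depend on the choice.\<close>
    obtain z where "z \<in> space P" using not_empty by auto
    with x have "x(l := z) \<in> space Q"
      using \<open>l \<in> J\<close> by (auto simp: space_PiM PiE_iff extensional_def)
    from measurable_upd_snd[OF assms this] have "(\<lambda>z. f (x(l := z))) \<in> borel_measurable P"
      by simp
    from nn_variance_copy[OF this]
    show "(\<integral>\<^sup>+y. \<integral>\<^sup>+z. ennreal ((f (x(l := y)) - f (x(l := z)))\<^sup>2) \<partial>P \<partial>P)
        = 2 * (\<integral>\<^sup>+y. ennreal ((f (x(l := y)) - coord_mean P l f x)\<^sup>2) \<partial>P)"
      by (simp add: coord_mean_def)
  qed
  also have "\<dots> = 2 * (\<integral>\<^sup>+x. (\<integral>\<^sup>+y. ennreal ((f (x(l := y)) - coord_mean P l f x)\<^sup>2) \<partial>P) \<partial>(\<Pi>\<^sub>M i\<in>J - {l}. P))"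
  proof (rule nn_integral_cmult)
    have *: "(\<lambda>(x, y). x(l := y)) \<in> measurable ((\<Pi>\<^sub>M i\<in>J - {l}. P) \<Otimes>\<^sub>M P) Q"
    proof -
      have "(\<lambda>p. (fst p)(l := snd p)) \<in> measurable ((\<Pi>\<^sub>M i\<in>J - {l}. P) \<Otimes>\<^sub>M P) Q"
        by (rule measurable_fun_upd[where J = "J - {l}"]) (use assms in auto)
      then show ?thesis by (simp add: case_prod_beta')
    qed
    have "(\<lambda>x. \<integral>\<^sup>+y. ennreal ((f (x(l := y)) - coord_mean P l f (x(l := y)))\<^sup>2) \<partial>P)
        \<in> borel_measurable (\<Pi>\<^sub>M i\<in>J - {l}. P)"
      using measurable_compose[OF * m2] by (intro borel_measurable_nn_integral) (simp add: case_prod_beta')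
    then show "(\<lambda>x. \<integral>\<^sup>+y. ennreal ((f (x(l := y)) - coord_mean P l f x)\<^sup>2) \<partial>P)
        \<in> borel_measurable (\<Pi>\<^sub>M i\<in>J - {l}. P)"
      by (simp add: coord_mean_def)
  qed
  also have "\<dots> = 2 * (\<integral>\<^sup>+x. ennreal ((f x - coord_mean P l f x)\<^sup>2) \<partial>Q)"
    unfolding nn_integral_split[OF \<open>l \<in> J\<close> m2] by (simp add: coord_mean_def)
  finally show ?thesis by simp
qed

end

text \<open>Induction on the coordinates. Averaging out \<open>i\<close> splits the second moment
  into the conditional variance given the others, which is half the influence of \<open>i\<close>,
  and the variance of the average \<open>g\<close>, covered by the induction hypothesis because
  averaging does not increase influences.\<close>

lemma Efron_Stein:
  fixes P :: "'z measure" and f :: "('i \<Rightarrow> 'z) \<Rightarrow> real"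
  assumes "prob_space P" "finite J" "f \<in> borel_measurable (\<Pi>\<^sub>M i\<in>J. P)"
  shows "2 * (\<integral>\<^sup>+x. ennreal ((f x - (\<integral>y. f y \<partial>(\<Pi>\<^sub>M i\<in>J. P)))\<^sup>2) \<partial>(\<Pi>\<^sub>M i\<in>J. P))
    \<le> (\<Sum>l\<in>J. coord_influence P J l f)"
  using assms(2,3)
proof (induction J arbitrary: f rule: finite_induct)
  case empty
  interpret iid_coords P "{}" using assms(1) by (simp add: iid_coords_def iid_coords_axioms_def)
  show ?case
    by (simp add: PiM_empty nn_integral_count_space_finite lebesgue_integral_count_space_finite)
next
  case (insert i I)
  interpret iid_coords P "insert i I" using assms(1) insert by (simp add: iid_coords_def iid_coords_axioms_def)
  interpret I: iid_coords P I using assms(1) insert by (simp add: iid_coords_def iid_coords_axioms_def)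
  note [measurable] = insert.prems
  define g where "g x = (\<integral>y. f (x(i := y)) \<partial>P)" for x
  have upd [measurable]: "(\<lambda>(x, y). x(i := y)) \<in> measurable (I.Q \<Otimes>\<^sub>M P) Q"
  proof -
    have "(\<lambda>p. (fst p)(i := snd p)) \<in> measurable (I.Q \<Otimes>\<^sub>M P) Q"
      by (rule measurable_fun_upd[where J = I]) auto
    then show ?thesis by (simp add: case_prod_beta')
  qed
  have fupd [measurable]: "(\<lambda>(x, y). f (x(i := y))) \<in> borel_measurable (I.Q \<Otimes>\<^sub>M P)"
    using measurable_compose[OF upd insert.prems] by (simp add: case_prod_beta')
  have fsec: "(\<lambda>y. f (x(i := y))) \<in> borel_measurable P" if "x \<in> space I.Q" for x
    using measurable_Pair2[OF fupd that] by simp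
  have [measurable]: "g \<in> borel_measurable I.Q"
    unfolding g_def by (rule borel_measurable_lebesgue_integral) measurable
  let ?V = "\<lambda>x. \<integral>\<^sup>+y. ennreal ((f (x(i := y)) - g x)\<^sup>2) \<partial>P"
  have Vm [measurable]: "?V \<in> borel_measurable I.Q"
    by (rule borel_measurable_nn_integral) measurable
  \<comment> \<open>The center is the mean of \<open>g\<close>, not of \<open>f\<close>: Fubini
    identifies the two only once \<open>f\<close> is known to be integrable, which is derived from
    the bound at the end.\<close>
  define c where "c = (\<integral>x. g x \<partial>I.Q)"
  have "(\<integral>\<^sup>+x. ennreal ((f x - c)\<^sup>2) \<partial>Q) = (\<integral>\<^sup>+x. \<integral>\<^sup>+y. ennreal ((f (x(i := y)) - c)\<^sup>2) \<partial>P \<partial>I.Q)"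
    using insert by (intro product_nn_integral_insert) auto
  also have "\<dots> = (\<integral>\<^sup>+x. ?V x + ennreal ((g x - c)\<^sup>2) \<partial>I.Q)"
    unfolding g_def by (intro nn_integral_cong nn_variance_shift fsec)
  also have "\<dots> = (\<integral>\<^sup>+x. ?V x \<partial>I.Q) + (\<integral>\<^sup>+x. ennreal ((g x - c)\<^sup>2) \<partial>I.Q)"
    by (rule nn_integral_add) auto
  finally have decomp: "2 * (\<integral>\<^sup>+x. ennreal ((f x - c)\<^sup>2) \<partial>Q)
      = 2 * (\<integral>\<^sup>+x. ?V x \<partial>I.Q) + 2 * (\<integral>\<^sup>+x. ennreal ((g x - c)\<^sup>2) \<partial>I.Q)"
    by (simp add: distrib_left)
  have "(\<integral>\<^sup>+x. ?V x \<partial>I.Q) = (\<integral>\<^sup>+x. ennreal ((f x - coord_mean P i f x)\<^sup>2) \<partial>Q)"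
  proof -
    have "(\<lambda>x. ennreal ((f x - coord_mean P i f x)\<^sup>2)) \<in> borel_measurable Q"
      using measurable_coord_mean[of i f] by simp
    from product_nn_integral_insert[OF insert.hyps(1,2) this] show ?thesis
      by (simp add: coord_mean_def g_def)
  qed
  then have first: "2 * (\<integral>\<^sup>+x. ?V x \<partial>I.Q) = coord_influence P (insert i I) i f"
    using two_nn_integral_coord_mean[of i f] by simp
  have infl: "coord_influence P I l g \<le> coord_influence P (insert i I) l f" if l: "l \<in> I" for l
  proof -
    have li: "l \<noteq> i" using l insert by auto
    have gm: "(\<lambda>x. \<integral>\<^sup>+z. ennreal ((f x - f (x(l := z)))\<^sup>2) \<partial>P) \<in> borel_measurable Q"
      using measurable_upd_pair[of l f borel] l by (intro borel_measurable_nn_integral) (auto simp: case_prod_beta')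
    \<comment> \<open>Jensen inside the average over coordinate \<open>i\<close>; the version for
      differences tolerates sections of \<open>f\<close> that are not integrable.\<close>
    have "coord_influence P I l g
        \<le> (\<integral>\<^sup>+x. \<integral>\<^sup>+z. \<integral>\<^sup>+y. ennreal ((f (x(i := y)) - f (x(l := z, i := y)))\<^sup>2) \<partial>P \<partial>P \<partial>I.Q)"
      unfolding coord_influence_def g_def
      by (intro nn_integral_mono nn_Jensen_square_diff fsec I.space_upd l)
    also have "\<dots> = (\<integral>\<^sup>+x. \<integral>\<^sup>+y. \<integral>\<^sup>+z. ennreal ((f (x(i := y)) - f (x(i := y, l := z)))\<^sup>2) \<partial>P \<partial>P \<partial>I.Q)"
    proof (rule nn_integral_cong)
      fix x assume x: "x \<in> space I.Q"
      interpret PP: pair_prob_space P P ..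
      have "(\<lambda>p. f (x(l := snd p, i := fst p))) \<in> borel_measurable (P \<Otimes>\<^sub>M P)"
      proof (rule measurable_compose[OF _ insert.prems])
        show "(\<lambda>p. x(l := snd p, i := fst p)) \<in> measurable (P \<Otimes>\<^sub>M P) Q"
          using l x by (intro measurable_fun_upd[where J = I]) auto
      qed
      moreover have "(\<lambda>p. f (x(i := fst p))) \<in> borel_measurable (P \<Otimes>\<^sub>M P)"
        using measurable_compose[OF measurable_fst fsec[OF x]] .
      ultimately have "(\<lambda>(y, z). ennreal ((f (x(i := y)) - f (x(l := z, i := y)))\<^sup>2)) \<in> borel_measurable (P \<Otimes>\<^sub>M P)"
        by (simp add: case_prod_beta')
      from PP.Fubini'[OF this]
      show "(\<integral>\<^sup>+z. \<integral>\<^sup>+y. ennreal ((f (x(i := y)) - f (x(l := z, i := y)))\<^sup>2) \<partial>P \<partial>P)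
          = (\<integral>\<^sup>+y. \<integral>\<^sup>+z. ennreal ((f (x(i := y)) - f (x(i := y, l := z)))\<^sup>2) \<partial>P \<partial>P)"
        using li by (simp add: fun_upd_twist[of l i])
    qed
    also have "\<dots> = coord_influence P (insert i I) l f"
      unfolding coord_influence_def
      using product_nn_integral_insert[OF insert.hyps(1,2) gm] by simp
    finally show ?thesis .
  qed
  have "2 * (\<integral>\<^sup>+x. ennreal ((g x - c)\<^sup>2) \<partial>I.Q) \<le> (\<Sum>l\<in>I. coord_influence P I l g)"
    unfolding c_def by (rule insert.IH) simp
  also have "\<dots> \<le> (\<Sum>l\<in>I. coord_influence P (insert i I) l f)"
    by (rule sum_mono) (rule infl)
  finally have bound: "2 * (\<integral>\<^sup>+x. ennreal ((f x - c)\<^sup>2) \<partial>Q) \<le> (\<Sum>l\<in>insert i I. coord_influence P (insert i I) l f)"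
    using insert.hyps unfolding decomp first by (simp add: add_left_mono)
  show ?case
  \<comment> \<open>An infinite right-hand side leaves nothing to prove; a finite one makes
    \<open>f\<close> integrable, and then \<open>c\<close> is its mean.\<close>
  proof (cases "(\<Sum>l\<in>insert i I. coord_influence P (insert i I) l f) = \<infinity>")
    case False
    with bound have "2 * (\<integral>\<^sup>+x. ennreal ((f x - c)\<^sup>2) \<partial>Q) < \<infinity>"
      by (simp add: top.not_eq_extremum le_less_trans)
    then have "(\<integral>\<^sup>+x. ennreal ((f x - c)\<^sup>2) \<partial>Q) < \<infinity>"
      by (auto simp: ennreal_mult_less_top)
    then have "integrable Q (\<lambda>x. (f x - c)\<^sup>2)"
      by (intro integrableI_bounded) auto
    then have "integrable Q (\<lambda>x. f x - c)"
      by (rule Q.square_integrable_imp_integrable[rotated]) simp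
    from Bochner_Integration.integrable_add[OF this, of "\<lambda>_. c"] have "integrable Q f"
      by simp
    from product_integral_insert[OF insert.hyps(1,2) this] have "(\<integral>y. f y \<partial>Q) = c"
      by (simp add: c_def g_def)
    with bound show ?thesis by simp
  next
    case True
    show ?thesis unfolding True by simp
  qed
qed

section \<open>Sums of functions that are centered in distinct coordinates\<close>

lemma integrable_square_iff:
  fixes f :: "'b \<Rightarrow> real"
  assumes "f \<in> borel_measurable A"
  shows "integrable A (\<lambda>x. (f x)\<^sup>2) \<longleftrightarrow> (\<integral>\<^sup>+x. ennreal ((f x)\<^sup>2) \<partial>A) < \<infinity>"
  using assms by (simp add: integrable_iff_bounded)

lemma integrable_mult_of_squares:
  fixes f g :: "'a \<Rightarrow> real"
  assumes [measurable]: "f \<in> borel_measurable M" "g \<in> borel_measurable M"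
    and "integrable M (\<lambda>x. (f x)\<^sup>2)" "integrable M (\<lambda>x. (g x)\<^sup>2)"
  shows "integrable M (\<lambda>x. f x * g x)"
proof (rule Bochner_Integration.integrable_bound)
  show "integrable M (\<lambda>x. (f x)\<^sup>2 + (g x)\<^sup>2)"
    using assms by simp
  have "\<bar>a * b\<bar> \<le> a\<^sup>2 + b\<^sup>2" for a b :: real
  proof -
    have "2 * (\<bar>a\<bar> * \<bar>b\<bar>) \<le> a\<^sup>2 + b\<^sup>2"
      using sum_squares_bound[of "\<bar>a\<bar>" "\<bar>b\<bar>"] by simp
    moreover have "0 \<le> \<bar>a\<bar> * \<bar>b\<bar>" by simp
    ultimately show ?thesis unfolding abs_mult by linarith
  qed
  then show "AE x in M. norm (f x * g x) \<le> norm ((f x)\<^sup>2 + (g x)\<^sup>2)"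
    by simp
qed simp

lemma integrable_add_squares:
  fixes f g :: "'a \<Rightarrow> real"
  assumes "f \<in> borel_measurable M" "g \<in> borel_measurable M"
    and "integrable M (\<lambda>x. (f x)\<^sup>2)" "integrable M (\<lambda>x. (g x)\<^sup>2)"
  shows "integrable M (\<lambda>x. (f x + g x)\<^sup>2)" "integrable M (\<lambda>x. (f x - g x)\<^sup>2)"
  using assms integrable_mult_of_squares[OF assms]
  by (simp_all add: power2_sum power2_diff mult.assoc)

context iid_coords
begin

text \<open>Demanded at every point and not just almost everywhere, so that it survives fixing
  another coordinate at an arbitrary value.\<close>

definition centered_at :: "'i \<Rightarrow> (('i \<Rightarrow> 'z) \<Rightarrow> real) \<Rightarrow> bool"
  where "centered_at i f \<longleftrightarrow> (\<forall>x\<in>space Q. coord_mean P i f x = 0)"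

text \<open>Fubini with coordinate \<open>i\<close> innermost; if \<open>f\<close> is not
  integrable, its integral is 0 by convention.\<close>

lemma integral_centered_at:
  assumes "i \<in> J" "centered_at i f"
  shows "(\<integral>x. f x \<partial>Q) = 0"
proof (cases "integrable Q f")
  case True
  obtain z where z: "z \<in> space P" using not_empty by auto
  have "(\<integral>y. f (x(i := y)) \<partial>P) = 0" if "x \<in> space (\<Pi>\<^sub>M i\<in>J - {i}. P)" for x
  proof -
    have "x(i := z) \<in> space Q"
      using that z \<open>i \<in> J\<close> by (auto simp: space_PiM PiE_iff extensional_def)
    with assms(2) have "coord_mean P i f (x(i := z)) = 0"
      by (auto simp: centered_at_def)
    then show ?thesis by (simp add: coord_mean_def)
  qed
  then have "(\<integral>x. \<integral>y. f (x(i := y)) \<partial>P \<partial>(\<Pi>\<^sub>M i\<in>J - {i}. P)) = (\<integral>x. 0 \<partial>(\<Pi>\<^sub>M i\<in>J - {i}. P))"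
    by (intro Bochner_Integration.integral_cong) auto
  then show ?thesis
    by (simp add: integral_split[OF assms(1) True])
qed (simp add: not_integrable_integral_eq)

text \<open>\<open>g\<close> is constant in coordinate \<open>i\<close> and can be taken out of the
  integral over it, so the product is still centered there.\<close>

lemma integral_centered_at_mult:
  assumes "i \<in> J" "centered_at i f"
    and "\<And>x z. x \<in> space Q \<Longrightarrow> z \<in> space P \<Longrightarrow> g (x(i := z)) = g x"
  shows "(\<integral>x. f x * g x \<partial>Q) = 0"
proof (rule integral_centered_at[OF assms(1)], unfold centered_at_def, rule ballI)
  fix x assume x: "x \<in> space Q"
  have "coord_mean P i (\<lambda>x. f x * g x) x = (\<integral>z. f (x(i := z)) * g x \<partial>P)"
    unfolding coord_mean_def using assms(3) x by (intro Bochner_Integration.integral_cong) auto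
  also have "\<dots> = 0"
    using assms(2) x by (simp add: centered_at_def coord_mean_def)
  finally show "coord_mean P i (\<lambda>x. f x * g x) x = 0" .
qed

text \<open>Averaging is a contraction in L2, by Jensen and
  \<open>nn_integral_resample\<close>.\<close>

lemma integrable_coord_mean_square:
  assumes "l \<in> J" and [measurable]: "f \<in> borel_measurable Q" and "integrable Q (\<lambda>x. (f x)\<^sup>2)"
  shows "integrable Q (\<lambda>x. (coord_mean P l f x)\<^sup>2)"
proof -
  have "(\<integral>\<^sup>+x. ennreal ((coord_mean P l f x)\<^sup>2) \<partial>Q)
      \<le> (\<integral>\<^sup>+x. \<integral>\<^sup>+z. ennreal ((f (x(l := z)))\<^sup>2) \<partial>P \<partial>Q)"
    unfolding coord_mean_def
    by (intro nn_integral_mono nn_Jensen_square measurable_upd_snd assms)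
  also have "\<dots> = (\<integral>\<^sup>+x. ennreal ((f x)\<^sup>2) \<partial>Q)"
    by (rule nn_integral_resample[OF assms(1)]) simp
  also have "\<dots> < \<infinity>"
    using assms by (simp add: integrable_square_iff)
  finally show ?thesis
    using measurable_coord_mean[OF assms(1,2)] by (simp add: integrable_square_iff)
qed

text \<open>Integrating over the resampled value of coordinate \<open>l\<close> last, the integrand is
  still centered at \<open>i\<close>.\<close>

lemma integral_coord_mean_mult:
  assumes "i \<in> J" "l \<in> J" "i \<noteq> l" "centered_at i f"
    and fm: "f \<in> borel_measurable Q" and f2: "integrable Q (\<lambda>x. (f x)\<^sup>2)"
    and gm: "g \<in> borel_measurable Q" and g2: "integrable Q (\<lambda>x. (g x)\<^sup>2)"
    and g: "\<And>x z. x \<in> space Q \<Longrightarrow> z \<in> space P \<Longrightarrow> g (x(i := z)) = g x"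
  shows "(\<integral>x. coord_mean P l f x * g x \<partial>Q) = 0"
proof -
  have m1: "(\<lambda>p. f ((fst p)(l := snd p))) \<in> borel_measurable (Q \<Otimes>\<^sub>M P)"
    using measurable_upd_pair[OF assms(2) fm] by (simp add: case_prod_beta')
  have m2: "(\<lambda>p. g (fst p)) \<in> borel_measurable (Q \<Otimes>\<^sub>M P)"
    by (rule measurable_compose[OF measurable_fst gm])
  \<comment> \<open>The updated vector has law \<open>Q\<close>, so both factors are square
    integrable over the pair; their product is integrable and Fubini may be applied.\<close>
  have "(\<integral>\<^sup>+p. ennreal ((f ((fst p)(l := snd p)))\<^sup>2) \<partial>(Q \<Otimes>\<^sub>M P)) = (\<integral>\<^sup>+x. ennreal ((f x)\<^sup>2) \<partial>Q)"
    using m1 fm by (simp add: nn_integral_fst[symmetric] nn_integral_resample[OF assms(2), of "\<lambda>x. ennreal ((f x)\<^sup>2)"])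
  with m1 fm f2 have i1: "integrable (Q \<Otimes>\<^sub>M P) (\<lambda>p. (f ((fst p)(l := snd p)))\<^sup>2)"
    by (simp add: integrable_square_iff)
  have "(\<integral>\<^sup>+p. ennreal ((g (fst p))\<^sup>2) \<partial>(Q \<Otimes>\<^sub>M P)) = (\<integral>\<^sup>+x. ennreal ((g x)\<^sup>2) \<partial>Q)"
    using m2 gm by (simp add: nn_integral_fst[symmetric] emeasure_space_1)
  with m2 gm g2 have i2: "integrable (Q \<Otimes>\<^sub>M P) (\<lambda>p. (g (fst p))\<^sup>2)"
    by (simp add: integrable_square_iff)
  have int: "integrable (Q \<Otimes>\<^sub>M P) (case_prod (\<lambda>x z. f (x(l := z)) * g x))"
    using integrable_mult_of_squares[OF m1 m2 i1 i2] by (simp add: case_prod_beta')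
  have "(\<integral>x. coord_mean P l f x * g x \<partial>Q) = (\<integral>x. \<integral>z. f (x(l := z)) * g x \<partial>P \<partial>Q)"
    by (simp add: coord_mean_def)
  also have "\<dots> = (\<integral>z. \<integral>x. f (x(l := z)) * g x \<partial>Q \<partial>P)"
    by (rule QP.Fubini_integral[OF int, symmetric])
  also have "\<dots> = (\<integral>z. 0 \<partial>P)"
  proof (rule Bochner_Integration.integral_cong[OF refl])
    fix z assume z: "z \<in> space P"
    show "(\<integral>x. f (x(l := z)) * g x \<partial>Q) = 0"
    proof (rule integral_centered_at_mult[OF assms(1)])
      show "centered_at i (\<lambda>x. f (x(l := z)))"
        unfolding centered_at_def
      proof
        fix x assume "x \<in> space Q"
        with assms(2,4) z have "coord_mean P i f (x(l := z)) = 0"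
          by (auto simp: centered_at_def intro: space_upd)
        then show "coord_mean P i (\<lambda>x. f (x(l := z))) x = 0"
          using \<open>i \<noteq> l\<close> by (simp add: coord_mean_def fun_upd_twist[of l i])
      qed
    qed (use g in auto)
  qed
  finally show ?thesis by simp
qed

text \<open>Expand \<open>(f - T_l f) (g - T_i g)\<close>. The three extra products integrate to 0:
  \<open>T_l f\<close> ignores \<open>l\<close>, where \<open>g\<close> is centered;
  \<open>T_i g\<close> ignores \<open>i\<close>, where \<open>f\<close> is centered; and averaging
  over \<open>l\<close> does not destroy the centering of \<open>f\<close> at \<open>i\<close>. The
  rest is \<open>a b \<le> (a^2 + b^2) / 2\<close>.\<close>

lemma integral_centered_product_le:
  assumes "i \<in> J" "l \<in> J" "i \<noteq> l" and fc: "centered_at i f" and gc: "centered_at l g"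
    and fm: "f \<in> borel_measurable Q" and f2: "integrable Q (\<lambda>x. (f x)\<^sup>2)"
    and gm: "g \<in> borel_measurable Q" and g2: "integrable Q (\<lambda>x. (g x)\<^sup>2)"
  shows "(\<integral>x. f x * g x \<partial>Q)
    \<le> ((\<integral>x. (f x - coord_mean P l f x)\<^sup>2 \<partial>Q) + (\<integral>x. (g x - coord_mean P i g x)\<^sup>2 \<partial>Q)) / 2"
proof -
  let ?Tf = "coord_mean P l f" and ?Tg = "coord_mean P i g"
  note Tfm = measurable_coord_mean[OF \<open>l \<in> J\<close> fm] and Tgm = measurable_coord_mean[OF \<open>i \<in> J\<close> gm]
  note Tf2 = integrable_coord_mean_square[OF \<open>l \<in> J\<close> fm f2]
    and Tg2 = integrable_coord_mean_square[OF \<open>i \<in> J\<close> gm g2]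
  note ints = integrable_mult_of_squares[OF fm gm f2 g2] integrable_mult_of_squares[OF gm Tfm g2 Tf2]
    integrable_mult_of_squares[OF fm Tgm f2 Tg2] integrable_mult_of_squares[OF Tfm Tgm Tf2 Tg2]
  note sqs = integrable_add_squares(2)[OF fm Tfm f2 Tf2] integrable_add_squares(2)[OF gm Tgm g2 Tg2]
  have "(\<integral>x. g x * ?Tf x \<partial>Q) = 0"
    by (rule integral_centered_at_mult[OF \<open>l \<in> J\<close> gc]) (simp add: coord_mean_def)
  moreover have "(\<integral>x. f x * ?Tg x \<partial>Q) = 0"
    by (rule integral_centered_at_mult[OF \<open>i \<in> J\<close> fc]) (simp add: coord_mean_def)
  moreover have "(\<integral>x. ?Tf x * ?Tg x \<partial>Q) = 0"
    by (rule integral_coord_mean_mult[OF assms(1-3) fc fm f2 Tgm Tg2]) (simp add: coord_mean_def)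
  ultimately have "(\<integral>x. f x * g x \<partial>Q) = (\<integral>x. f x * g x - g x * ?Tf x - f x * ?Tg x + ?Tf x * ?Tg x \<partial>Q)"
    using ints by simp
  also have "\<dots> \<le> (\<integral>x. ((f x - ?Tf x)\<^sup>2 + (g x - ?Tg x)\<^sup>2) / 2 \<partial>Q)"
  proof (rule integral_mono)
    fix x
    have "f x * g x - g x * ?Tf x - f x * ?Tg x + ?Tf x * ?Tg x = (f x - ?Tf x) * (g x - ?Tg x)"
      by (simp add: algebra_simps)
    moreover have "a * b \<le> (a\<^sup>2 + b\<^sup>2) / 2" for a b :: real
      using sum_squares_bound[of a b] by simp
    ultimately show "f x * g x - g x * ?Tf x - f x * ?Tg x + ?Tf x * ?Tg x \<le> ((f x - ?Tf x)\<^sup>2 + (g x - ?Tg x)\<^sup>2) / 2"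
      by presburger
  qed (use ints sqs in auto)
  also have "\<dots> = ((\<integral>x. (f x - ?Tf x)\<^sup>2 \<partial>Q) + (\<integral>x. (g x - ?Tg x)\<^sup>2 \<partial>Q)) / 2"
    using sqs by simp
  finally show ?thesis .
qed

text \<open>The double sum over pairs is symmetric, so the two halves from
  \<open>integral_centered_product_le\<close> combine into one full sum over pairs of different
  indices. As \<open>c\<close> is injective, each row of it meets a coordinate at most once.\<close>

lemma second_moment_sum_le:
  assumes "finite K" "inj_on c K" "c ` K \<subseteq> J"
    and cent: "\<And>\<kappa>. \<kappa> \<in> K \<Longrightarrow> centered_at (c \<kappa>) (W \<kappa>)"
    and meas: "\<And>\<kappa>. \<kappa> \<in> K \<Longrightarrow> W \<kappa> \<in> borel_measurable Q"
    and sq: "\<And>\<kappa>. \<kappa> \<in> K \<Longrightarrow> integrable Q (\<lambda>x. (W \<kappa> x)\<^sup>2)"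
  shows "(\<integral>x. (\<Sum>\<kappa>\<in>K. W \<kappa> x)\<^sup>2 \<partial>Q) \<le> (\<Sum>\<kappa>\<in>K. (\<integral>x. (W \<kappa> x)\<^sup>2 \<partial>Q)
      + (\<Sum>l\<in>J - {c \<kappa>}. \<integral>x. (W \<kappa> x - coord_mean P l (W \<kappa>) x)\<^sup>2 \<partial>Q))"
proof -
  define v where "v \<kappa> l = (\<integral>x. (W \<kappa> x - coord_mean P l (W \<kappa>) x)\<^sup>2 \<partial>Q)" for \<kappa> l
  \<comment> \<open>A zero diagonal allows one bound for equal and for different indices, hence
    summation over all of \<open>K \<times> K\<close>.\<close>
  define u where "u \<kappa> \<kappa>' = (if \<kappa> = \<kappa>' then 0 else v \<kappa> (c \<kappa>'))" for \<kappa> \<kappa>'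
  have prod: "integrable Q (\<lambda>x. W \<kappa> x * W \<kappa>' x)" if "\<kappa> \<in> K" "\<kappa>' \<in> K" for \<kappa> \<kappa>'
    using that by (intro integrable_mult_of_squares meas sq)
  have cross: "(\<integral>x. W \<kappa> x * W \<kappa>' x \<partial>Q)
      \<le> (if \<kappa> = \<kappa>' then \<integral>x. (W \<kappa> x)\<^sup>2 \<partial>Q else 0) + (u \<kappa> \<kappa>' + u \<kappa>' \<kappa>) / 2"
    if "\<kappa> \<in> K" "\<kappa>' \<in> K" for \<kappa> \<kappa>'
  proof (cases "\<kappa> = \<kappa>'")
    case True
    then show ?thesis by (simp add: u_def power2_eq_square)
  next
    case False
    then have "c \<kappa> \<noteq> c \<kappa>'" using assms(2) that by (auto dest: inj_onD)
    moreover have "c \<kappa> \<in> J" "c \<kappa>' \<in> J" using assms(3) that by auto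
    ultimately show ?thesis
      using integral_centered_product_le[of "c \<kappa>" "c \<kappa>'" "W \<kappa>" "W \<kappa>'"] cent meas sq that False
      by (simp add: u_def v_def)
  qed
  have row: "(\<Sum>\<kappa>'\<in>K. u \<kappa> \<kappa>') \<le> (\<Sum>l\<in>J - {c \<kappa>}. v \<kappa> l)" if "\<kappa> \<in> K" for \<kappa>
  proof -
    have "(\<Sum>\<kappa>'\<in>K. u \<kappa> \<kappa>') = (\<Sum>\<kappa>'\<in>K - {\<kappa>}. v \<kappa> (c \<kappa>'))"
      using assms(1) that by (intro sum.mono_neutral_cong_right) (auto simp: u_def)
    also have "\<dots> = (\<Sum>l\<in>c ` (K - {\<kappa>}). v \<kappa> l)"
      using inj_on_subset[OF assms(2)] by (subst sum.reindex) auto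
    \<comment> \<open>Coordinates at which no summand is centered only add nonnegative
      terms.\<close>
    also have "\<dots> \<le> (\<Sum>l\<in>J - {c \<kappa>}. v \<kappa> l)"
      using assms(2,3) that by (intro sum_mono2) (auto simp: v_def dest: inj_onD)
    finally show ?thesis .
  qed
  have "(\<integral>x. (\<Sum>\<kappa>\<in>K. W \<kappa> x)\<^sup>2 \<partial>Q) = (\<integral>x. (\<Sum>\<kappa>\<in>K. \<Sum>\<kappa>'\<in>K. W \<kappa> x * W \<kappa>' x) \<partial>Q)"
    by (simp add: power2_eq_square sum_product)
  also have "\<dots> = (\<Sum>\<kappa>\<in>K. \<Sum>\<kappa>'\<in>K. \<integral>x. W \<kappa> x * W \<kappa>' x \<partial>Q)"
    using prod by (simp add: Bochner_Integration.integral_sum)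
  also have "\<dots> \<le> (\<Sum>\<kappa>\<in>K. \<Sum>\<kappa>'\<in>K. (if \<kappa> = \<kappa>' then \<integral>x. (W \<kappa> x)\<^sup>2 \<partial>Q else 0) + (u \<kappa> \<kappa>' + u \<kappa>' \<kappa>) / 2)"
    by (intro sum_mono cross)
  also have "\<dots> = (\<Sum>\<kappa>\<in>K. \<integral>x. (W \<kappa> x)\<^sup>2 \<partial>Q) + ((\<Sum>\<kappa>\<in>K. \<Sum>\<kappa>'\<in>K. u \<kappa> \<kappa>') + (\<Sum>\<kappa>\<in>K. \<Sum>\<kappa>'\<in>K. u \<kappa>' \<kappa>)) / 2"
    using assms(1) by (simp add: sum.distrib sum_divide_distrib[symmetric])
  also have "(\<Sum>\<kappa>\<in>K. \<Sum>\<kappa>'\<in>K. u \<kappa>' \<kappa>) = (\<Sum>\<kappa>\<in>K. \<Sum>\<kappa>'\<in>K. u \<kappa> \<kappa>')"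
    by (rule sum.swap)
  also have "(\<Sum>\<kappa>\<in>K. \<integral>x. (W \<kappa> x)\<^sup>2 \<partial>Q) + ((\<Sum>\<kappa>\<in>K. \<Sum>\<kappa>'\<in>K. u \<kappa> \<kappa>') + (\<Sum>\<kappa>\<in>K. \<Sum>\<kappa>'\<in>K. u \<kappa> \<kappa>')) / 2
      \<le> (\<Sum>\<kappa>\<in>K. (\<integral>x. (W \<kappa> x)\<^sup>2 \<partial>Q) + (\<Sum>l\<in>J - {c \<kappa>}. v \<kappa> l))"
    using sum_mono[OF row] by (simp add: sum.distrib)
  finally show ?thesis by (simp add: v_def)
qed

text \<open>\<open>a\<close> bounds twice the diagonal moment as well as the total influence, itself
  twice the sum of squared distances to the coordinate means, so each index costs
  \<open>a / 2 + a / 2\<close>. If \<open>a\<close> is finite, \<open>diag\<close> supplies the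
  square integrability.\<close>

lemma nn_second_moment_sum_le:
  fixes a :: ennreal
  assumes "finite K" "inj_on c K" "c ` K \<subseteq> J"
    and cent: "\<And>\<kappa>. \<kappa> \<in> K \<Longrightarrow> centered_at (c \<kappa>) (W \<kappa>)"
    and meas: "\<And>\<kappa>. \<kappa> \<in> K \<Longrightarrow> W \<kappa> \<in> borel_measurable Q"
    and diag: "\<And>\<kappa>. \<kappa> \<in> K \<Longrightarrow> 2 * (\<integral>\<^sup>+x. ennreal ((W \<kappa> x)\<^sup>2) \<partial>Q) \<le> a"
    and infl: "\<And>\<kappa>. \<kappa> \<in> K \<Longrightarrow> (\<Sum>l\<in>J - {c \<kappa>}. coord_influence P J l (W \<kappa>)) \<le> a"
  shows "(\<integral>\<^sup>+x. ennreal ((\<Sum>\<kappa>\<in>K. W \<kappa> x)\<^sup>2) \<partial>Q) \<le> of_nat (card K) * a"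
proof (cases a)
  case (real r)
  have sq: "integrable Q (\<lambda>x. (W \<kappa> x)\<^sup>2)" if "\<kappa> \<in> K" for \<kappa>
  proof -
    have "2 * (\<integral>\<^sup>+x. ennreal ((W \<kappa> x)\<^sup>2) \<partial>Q) < \<infinity>"
      using diag[OF that] real by (simp add: le_less_trans)
    then have "(\<integral>\<^sup>+x. ennreal ((W \<kappa> x)\<^sup>2) \<partial>Q) < \<infinity>"
      by (auto simp: ennreal_mult_less_top)
    then show ?thesis
      using meas[OF that] by (simp add: integrable_square_iff)
  qed
  have nn_sq: "(\<integral>\<^sup>+x. ennreal ((f x)\<^sup>2) \<partial>Q) = ennreal (\<integral>x. (f x)\<^sup>2 \<partial>Q)"
    if "integrable Q (\<lambda>x. (f x)\<^sup>2)" for f :: "('i \<Rightarrow> 'z) \<Rightarrow> real"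
    using that by (intro nn_integral_eq_integral) auto
  have d: "(\<integral>x. (W \<kappa> x)\<^sup>2 \<partial>Q) \<le> r / 2" if "\<kappa> \<in> K" for \<kappa>
  proof -
    have "ennreal (2 * (\<integral>x. (W \<kappa> x)\<^sup>2 \<partial>Q)) \<le> ennreal r"
      using diag[OF that] real by (simp add: nn_sq[OF sq[OF that]] ennreal_mult)
    then show ?thesis using real by simp
  qed
  have o: "(\<Sum>l\<in>J - {c \<kappa>}. \<integral>x. (W \<kappa> x - coord_mean P l (W \<kappa>) x)\<^sup>2 \<partial>Q) \<le> r / 2" if "\<kappa> \<in> K" for \<kappa>
  proof -
    have "coord_influence P J l (W \<kappa>) = ennreal (2 * (\<integral>x. (W \<kappa> x - coord_mean P l (W \<kappa>) x)\<^sup>2 \<partial>Q))"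
      if "l \<in> J" for l
      using that \<open>\<kappa> \<in> K\<close> meas sq
      by (simp add: two_nn_integral_coord_mean[symmetric] ennreal_mult nn_sq integrable_add_squares
          integrable_coord_mean_square measurable_coord_mean)
    then have "(\<Sum>l\<in>J - {c \<kappa>}. coord_influence P J l (W \<kappa>))
        = ennreal (\<Sum>l\<in>J - {c \<kappa>}. 2 * (\<integral>x. (W \<kappa> x - coord_mean P l (W \<kappa>) x)\<^sup>2 \<partial>Q))"
      by (simp add: sum_ennreal)
    with infl[OF that] real show ?thesis
      by (simp add: sum_distrib_left[symmetric])
  qed
  have S2: "integrable Q (\<lambda>x. (\<Sum>\<kappa>\<in>K. W \<kappa> x)\<^sup>2)"
    unfolding power2_eq_square sum_product
    by (intro Bochner_Integration.integrable_sum integrable_mult_of_squares meas sq)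
  have "(\<integral>x. (\<Sum>\<kappa>\<in>K. W \<kappa> x)\<^sup>2 \<partial>Q) \<le> (\<Sum>\<kappa>\<in>K. (\<integral>x. (W \<kappa> x)\<^sup>2 \<partial>Q)
      + (\<Sum>l\<in>J - {c \<kappa>}. \<integral>x. (W \<kappa> x - coord_mean P l (W \<kappa>) x)\<^sup>2 \<partial>Q))"
    by (rule second_moment_sum_le[OF assms(1-3) cent meas sq])
  also have "\<dots> \<le> (\<Sum>\<kappa>\<in>K. r / 2 + r / 2)"
    by (intro sum_mono add_mono d o)
  finally have "(\<integral>x. (\<Sum>\<kappa>\<in>K. W \<kappa> x)\<^sup>2 \<partial>Q) \<le> real (card K) * r"
    by simp
  then show ?thesis
    unfolding nn_sq[OF S2] using real
    by (simp add: ennreal_mult[symmetric] ennreal_of_nat_eq_real_of_nat)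
next
  case top
  \<comment> \<open>For empty \<open>K\<close> the right-hand side is 0 times infinity, that is 0,
    but so is the left-hand side.\<close>
  then show ?thesis
    using assms(1) by (cases "K = {}") (auto simp: ennreal_mult_top)
qed

end

section \<open>Conditional expectations given one of two independent random elements\<close>

lemma (in pair_prob_space) integrable_compose_snd:
  fixes f :: "'b \<Rightarrow> real"
  assumes f: "integrable M2 f"
  shows "integrable (M1 \<Otimes>\<^sub>M M2) (\<lambda>p. f (snd p))"
proof -
  have [measurable]: "f \<in> borel_measurable M2"
    using f by auto
  have "(\<integral>\<^sup>+p. ennreal (norm (f (snd p))) \<partial>(M1 \<Otimes>\<^sub>M M2)) = (\<integral>\<^sup>+y. ennreal (norm (f y)) \<partial>M2)"
    using nn_integral_snd[of "\<lambda>p. ennreal (norm (f (snd p)))"] by (simp add: M1.emeasure_space_1)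
  then show ?thesis
    using f by (simp add: integrable_iff_bounded)
qed

lemma (in pair_prob_space) integrable_compose_fst:
  fixes f :: "'a \<Rightarrow> real"
  assumes f: "integrable M1 f"
  shows "integrable (M1 \<Otimes>\<^sub>M M2) (\<lambda>p. f (fst p))"
proof -
  have [measurable]: "f \<in> borel_measurable M1"
    using f by auto
  have "(\<integral>\<^sup>+p. ennreal (norm (f (fst p))) \<partial>(M1 \<Otimes>\<^sub>M M2)) = (\<integral>\<^sup>+x. ennreal (norm (f x)) \<partial>M1)"
    using M2.nn_integral_fst[of "\<lambda>p. ennreal (norm (f (fst p)))"] by (simp add: M2.emeasure_space_1)
  then show ?thesis
    using f by (simp add: integrable_iff_bounded)
qed

text \<open>Freezing of \<open>X\<close>; independence enters as a product joint law. The candidate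
  is tested on preimages of sets \<open>C\<close> under \<open>X\<close>, where the indicator is a
  function of \<open>X\<close> alone and Fubini evaluates both sides.\<close>

lemma (in prob_space) cond_exp_given_independent:
  fixes f :: "'b \<Rightarrow> 'c \<Rightarrow> real"
  assumes "prob_space P" "prob_space R"
    and XY: "X \<in> measurable M P" "Y \<in> measurable M R"
    and law: "distr M (P \<Otimes>\<^sub>M R) (\<lambda>\<omega>. (X \<omega>, Y \<omega>)) = P \<Otimes>\<^sub>M R"
    and f: "integrable (P \<Otimes>\<^sub>M R) (case_prod f)"
  shows "AE \<omega> in M. cond_exp_given M P X (\<lambda>\<omega>. f (X \<omega>) (Y \<omega>)) \<omega> = (\<integral>y. f (X \<omega>) y \<partial>R)"
proof -
  interpret P: prob_space P by fact
  interpret R: prob_space R by fact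
  interpret PR: pair_prob_space P R ..
  let ?F = "vimage_algebra (space M) X P"
  have "subalgebra M ?F"
    using measurable_sets[OF XY(1)]
    by (auto simp: subalgebra_def sets_vimage_algebra2[OF measurable_space[OF XY(1), THEN funcsetI]])
  then interpret F: sigma_finite_subalgebra M ?F
    using finite_measure_axioms
    by (intro finite_measure_subalgebra_is_sigma_finite finite_measure_subalgebra.intro
        finite_measure_subalgebra_axioms.intro)
  have T: "(\<lambda>\<omega>. (X \<omega>, Y \<omega>)) \<in> measurable M (P \<Otimes>\<^sub>M R)"
    using XY by simp
  have int: "integrable M (\<lambda>\<omega>. G (X \<omega>, Y \<omega>))" if "integrable (P \<Otimes>\<^sub>M R) G" for G :: "_ \<Rightarrow> real"
    using that integrable_distr[OF T, of G] law by simp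
  have lint: "(\<integral>\<omega>. G (X \<omega>, Y \<omega>) \<partial>M) = (\<integral>x. \<integral>y. G (x, y) \<partial>R \<partial>P)"
    if "integrable (P \<Otimes>\<^sub>M R) G" for G :: "_ \<Rightarrow> real"
    using that integral_distr[OF T, of G] law PR.integral_fst'[OF that] by simp
  define g where "g x = (\<integral>y. f x y \<partial>R)" for x
  have g: "integrable P g"
    unfolding g_def using PR.integrable_fst'[OF f] by simp
  note g1 = PR.integrable_compose_fst[OF g]
  have "AE \<omega> in M. real_cond_exp M ?F (\<lambda>\<omega>. f (X \<omega>) (Y \<omega>)) \<omega> = g (X \<omega>)"
  proof (rule F.real_cond_exp_charact)
    show "integrable M (\<lambda>\<omega>. f (X \<omega>) (Y \<omega>))" "integrable M (\<lambda>\<omega>. g (X \<omega>))"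
      using int[OF f] int[OF g1] by simp_all
    have "X \<in> measurable ?F P"
      by (rule measurable_vimage_algebra1) (use measurable_space[OF XY(1)] in auto)
    from measurable_compose[OF this borel_measurable_integrable[OF g]]
    show "(\<lambda>\<omega>. g (X \<omega>)) \<in> borel_measurable ?F" .
    fix A assume "A \<in> sets ?F"
    then obtain C where C: "C \<in> sets P" "A = X -` C \<inter> space M"
      using XY(1)[THEN measurable_space] by (auto simp: sets_vimage_algebra2)
    have ind: "integrable (P \<Otimes>\<^sub>M R) (\<lambda>p. indicat_real C (fst p) * G p)" if "integrable (P \<Otimes>\<^sub>M R) G" for G
    proof (rule Bochner_Integration.integrable_bound[OF that])
      show "(\<lambda>p. indicat_real C (fst p) * G p) \<in> borel_measurable (P \<Otimes>\<^sub>M R)"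
        using C(1) that by measurable
    qed (auto simp: indicator_def)
    have A: "set_lebesgue_integral M A G = (\<integral>\<omega>. indicat_real C (X \<omega>) * G \<omega> \<partial>M)" for G
      unfolding set_lebesgue_integral_def C(2)
      by (intro Bochner_Integration.integral_cong) (auto simp: indicator_def)
    show "set_lebesgue_integral M A (\<lambda>\<omega>. f (X \<omega>) (Y \<omega>)) = set_lebesgue_integral M A (\<lambda>\<omega>. g (X \<omega>))"
      unfolding A using lint[OF ind[OF f]] lint[OF ind[OF g1]] by (simp add: g_def R.prob_space)
  qed
  then show ?thesis
    by (simp add: cond_exp_given_def g_def)
qed

text \<open>Conditioning sees only the generated sigma-algebra, so the space \<open>N\<close> of the
  theorem can be exchanged for the law of a datapoint.\<close>

lemma cond_exp_given_cong:
  assumes "sets N = sets P"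
  shows "cond_exp_given M N X f = cond_exp_given M P X f"
  unfolding cond_exp_given_def by (subst vimage_algebra_cong[OF refl refl assms]) (rule refl)

section \<open>The loss with training points drawn from a product measure\<close>

text \<open>Selecting distinct coordinates of a product law gives a product law again, here over
  \<open>length B + 1\<close> positions, the last of which is split off as the validation
  point.\<close>

lemma (in iid_coords) distr_coord_subvec:
  assumes "distinct B" "set B \<subseteq> J" "i \<in> J" "i \<notin> set B"
  shows "distr Q (P \<Otimes>\<^sub>M vecs P (length B)) (\<lambda>x. (x i, \<lambda>l\<in>{..<length B}. x (B ! l)))
    = P \<Otimes>\<^sub>M vecs P (length B)"
proof -
  let ?m = "length B"
  \<comment> \<open>Position \<open>?m\<close> is a spare slot for \<open>i\<close>;
    \<open>?f\<close> is injective because \<open>B\<close> is distinct and avoids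
    \<open>i\<close>.\<close>
  let ?f = "\<lambda>l. if l = ?m then i else B ! l"
  let ?L = "\<Pi>\<^sub>M l\<in>insert ?m {..<?m}. P"
  let ?split = "\<lambda>y. (y ?m, restrict y {..<?m})"
  have inj: "inj_on ?f (insert ?m {..<?m})"
  proof (rule inj_onI)
    fix a b assume "a \<in> insert ?m {..<?m}" "b \<in> insert ?m {..<?m}" "?f a = ?f b"
    then show "a = b"
      using assms(1,4) nth_mem[of a B] nth_mem[of b B] by (auto simp: nth_eq_iff_index_eq split: if_splits)
  qed
  have 1: "distr Q ?L (\<lambda>x. \<lambda>l\<in>insert ?m {..<?m}. x (?f l)) = ?L"
    by (rule distr_PiM_reindex[where M = "\<lambda>_. P" and K = J and f = ?f, OF _ inj])
      (use assms prob_space_axioms in \<open>auto dest: nth_mem\<close>)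
  have 2: "distr (P \<Otimes>\<^sub>M vecs P ?m) ?L (\<lambda>(y, Y). Y(?m := y)) = ?L"
    by (rule distr_pair_PiM_eq_PiM) (auto intro: prob_space_axioms)
  have m1: "(\<lambda>x. \<lambda>l\<in>insert ?m {..<?m}. x (?f l)) \<in> measurable Q ?L"
    using assms by (intro measurable_restrict measurable_component_singleton) (auto dest: nth_mem)
  have m2: "(\<lambda>(y, Y). Y(?m := y)) \<in> measurable (P \<Otimes>\<^sub>M vecs P ?m) ?L"
  proof -
    have "(\<lambda>p. (snd p)(?m := fst p)) \<in> measurable (P \<Otimes>\<^sub>M vecs P ?m) ?L"
      by (rule measurable_fun_upd[where J = "{..<?m}"]) auto
    then show ?thesis by (simp add: case_prod_beta')
  qed
  have m3: "?split \<in> measurable ?L (P \<Otimes>\<^sub>M vecs P ?m)"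
    by (intro measurable_Pair measurable_component_singleton measurable_restrict_subset) auto
  \<comment> \<open>\<open>?split\<close> undoes the update in \<open>2\<close>, so it carries the
    law on all positions back to the pair law.\<close>
  have "distr ?L (P \<Otimes>\<^sub>M vecs P ?m) ?split = P \<Otimes>\<^sub>M vecs P ?m"
  proof -
    have "distr ?L (P \<Otimes>\<^sub>M vecs P ?m) ?split
        = distr (P \<Otimes>\<^sub>M vecs P ?m) (P \<Otimes>\<^sub>M vecs P ?m) (?split \<circ> (\<lambda>(y, Y). Y(?m := y)))"
      by (subst 2[symmetric]) (rule distr_distr[OF m3 m2])
    also have "\<dots> = distr (P \<Otimes>\<^sub>M vecs P ?m) (P \<Otimes>\<^sub>M vecs P ?m) (\<lambda>p. p)"
    proof (rule distr_cong[OF refl refl])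
      fix p assume "p \<in> space (P \<Otimes>\<^sub>M vecs P ?m)"
      then obtain y Y where p: "p = (y, Y)" and "Y \<in> space (vecs P ?m)"
        by (auto simp: space_pair_measure)
      then have "Y \<in> extensional {..<?m}"
        by (simp add: space_PiM PiE_iff)
      then have "restrict (Y(?m := y)) {..<?m} = Y"
        by (intro extensionalityI[of _ "{..<?m}"]) auto
      then show "(?split \<circ> (\<lambda>(y, Y). Y(?m := y))) p = p"
        by (simp add: p)
    qed
    finally show ?thesis by simp
  qed
  moreover have "distr ?L (P \<Otimes>\<^sub>M vecs P ?m) ?split
      = distr Q (P \<Otimes>\<^sub>M vecs P ?m) (?split \<circ> (\<lambda>x. \<lambda>l\<in>insert ?m {..<?m}. x (?f l)))"
    by (subst 1[symmetric]) (rule distr_distr[OF m3 m1])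
  moreover have "?split \<circ> (\<lambda>x. \<lambda>l\<in>insert ?m {..<?m}. x (?f l)) = (\<lambda>x :: 'i \<Rightarrow> 'z. (x i, \<lambda>l\<in>{..<?m}. x (B ! l)))"
    by (auto simp: fun_eq_iff restrict_def)
  ultimately show ?thesis by (simp only:)
qed

section \<open>The centered loss and its projection on the validation point\<close>

locale iid_loss = prob_space P for P :: "'z measure" +
  fixes m :: nat and h :: "'z \<Rightarrow> (nat \<Rightarrow> 'z) \<Rightarrow> real"
  assumes integrable_h: "integrable (P \<Otimes>\<^sub>M vecs P m) (case_prod h)"
begin

sublocale D: iid_coords P "{..<m}"
  by standard auto

sublocale PD: pair_prob_space P "vecs P m" ..

abbreviation "h' \<equiv> centered_loss P h"

text \<open>A version of the conditional expectation of the centered loss given the validation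
  point. For almost every \<open>z\<close> it is also the mean loss minus its expectation, which is
  why both claims lead to the same \<open>phi\<close>.\<close>

definition "psi z = (\<integral>D. h' z D \<partial>vecs P m)"

definition "phi z D = h' z D - psi z"

lemma h'_eq: "case_prod h' = (\<lambda>p. case_prod h p - (\<integral>z. h z (snd p) \<partial>P))"
  by (auto simp: centered_loss_def)

lemma measurable_h [measurable]: "case_prod h \<in> borel_measurable (P \<Otimes>\<^sub>M vecs P m)"
  using integrable_h by auto

lemma integrable_h': "integrable (P \<Otimes>\<^sub>M vecs P m) (case_prod h')"
proof -
  have "integrable (vecs P m) (\<lambda>D. \<integral>z. h z D \<partial>P)"
    using PD.integrable_snd[of "\<lambda>z D. h z D"] integrable_h by simp
  then have "integrable (P \<Otimes>\<^sub>M vecs P m) (\<lambda>p. \<integral>z. h z (snd p) \<partial>P)"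
    by (rule PD.integrable_compose_snd)
  then show ?thesis
    unfolding h'_eq by (intro Bochner_Integration.integrable_diff integrable_h)
qed

lemma measurable_h' [measurable]: "case_prod h' \<in> borel_measurable (P \<Otimes>\<^sub>M vecs P m)"
  using integrable_h' by auto

lemma measurable_h'_snd: "z \<in> space P \<Longrightarrow> h' z \<in> borel_measurable (vecs P m)"
  using measurable_Pair2[OF measurable_h'] by simp

text \<open>Valid for every \<open>D\<close>: where the section of \<open>h\<close> is not
  integrable, neither is that of \<open>h'\<close>, and its integral is 0 by convention.\<close>

lemma integral_h'_fst: "(\<integral>z. h' z D \<partial>P) = 0"
proof (cases "integrable P (\<lambda>z. h z D)")
  case True
  then show ?thesis by (simp add: centered_loss_def prob_space)
next
  case False
  have "\<not> integrable P (\<lambda>z. h' z D)"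
  proof
    assume "integrable P (\<lambda>z. h' z D)"
    from Bochner_Integration.integrable_add[OF this, of "\<lambda>_. \<integral>z. h z D \<partial>P"] False show False
      by (simp add: centered_loss_def)
  qed
  then show ?thesis by (rule not_integrable_integral_eq)
qed

lemma integrable_psi: "integrable P psi"
  unfolding psi_def[abs_def] by (rule PD.integrable_fst'[OF integrable_h', simplified])

lemma integral_psi: "(\<integral>z. psi z \<partial>P) = 0"
proof -
  have "(\<integral>z. psi z \<partial>P) = (\<integral>D. \<integral>z. h' z D \<partial>P \<partial>vecs P m)"
    unfolding psi_def using PD.Fubini_integral[of h'] integrable_h' by simp
  then show ?thesis by (simp add: integral_h'_fst)
qed

lemma integrable_phi: "integrable (P \<Otimes>\<^sub>M vecs P m) (case_prod phi)"
proof -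
  have "case_prod phi = (\<lambda>p. case_prod h' p - psi (fst p))"
    by (auto simp: phi_def)
  then show ?thesis
    using integrable_h' PD.integrable_compose_fst[OF integrable_psi] by simp
qed

lemma measurable_phi [measurable]: "case_prod phi \<in> borel_measurable (P \<Otimes>\<^sub>M vecs P m)"
  using integrable_phi by auto

text \<open>Since \<open>psi\<close> is integrable, \<open>h'\<close> and \<open>phi\<close> have
  the same integrable sections, and the default value 0 settles the others. This gives centering at
  every point, as \<open>centered_at\<close> demands.\<close>

lemma integral_phi_fst: "(\<integral>z. phi z D \<partial>P) = 0"
proof (cases "integrable P (\<lambda>z. h' z D)")
  case True
  then show ?thesis by (simp add: phi_def integrable_psi integral_psi integral_h'_fst)
next
  case False
  have "\<not> integrable P (\<lambda>z. phi z D)"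
  proof
    assume "integrable P (\<lambda>z. phi z D)"
    from Bochner_Integration.integrable_add[OF this integrable_psi] False show False
      by (simp add: phi_def)
  qed
  then show ?thesis by (rule not_integrable_integral_eq)
qed

lemma integral_phi: "(\<integral>q. case_prod phi q \<partial>(P \<Otimes>\<^sub>M vecs P m)) = 0"
  using PD.integral_snd[OF integrable_phi] by (simp add: integral_phi_fst)

lemma measurable_replace:
  assumes "p < m"
  shows "(\<lambda>(q, z'). h' (fst q) (snd q) - h' (fst q) ((snd q)(p := z')))
    \<in> borel_measurable ((P \<Otimes>\<^sub>M vecs P m) \<Otimes>\<^sub>M P)"
proof -
  have "(\<lambda>r. (fst (fst r), (snd (fst r))(p := snd r)))
      \<in> measurable ((P \<Otimes>\<^sub>M vecs P m) \<Otimes>\<^sub>M P) (P \<Otimes>\<^sub>M vecs P m)"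
    using assms by (intro measurable_Pair measurable_fun_upd[where J = "{..<m}"]) auto
  from measurable_compose[OF this measurable_h']
    measurable_compose[OF measurable_fst measurable_h', of P]
  show ?thesis by (simp add: case_prod_beta')
qed

lemma measurable_influence:
  assumes "p < m"
  shows "(\<lambda>(z, D). \<integral>\<^sup>+z'. ennreal ((h' z D - h' z (D(p := z')))\<^sup>2) \<partial>P) \<in> borel_measurable (P \<Otimes>\<^sub>M vecs P m)"
proof -
  have "(\<lambda>q. \<integral>\<^sup>+z'. ennreal ((h' (fst q) (snd q) - h' (fst q) ((snd q)(p := z')))\<^sup>2) \<partial>P)
      \<in> borel_measurable (P \<Otimes>\<^sub>M vecs P m)"
    using measurable_replace[OF assms] by (intro borel_measurable_nn_integral) (simp add: case_prod_beta')
  then show ?thesis by (simp add: case_prod_beta')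
qed

text \<open>Tonelli: stability integrates \<open>z'\<close> and \<open>D\<close> jointly, whereas
  the influence has \<open>z'\<close> innermost.\<close>

lemma influence_eq:
  assumes "p < m"
  shows "(\<integral>\<^sup>+(z, z', D). ennreal ((h' z D - h' z (D(p := z')))\<^sup>2) \<partial>(P \<Otimes>\<^sub>M P \<Otimes>\<^sub>M vecs P m))
    = (\<integral>\<^sup>+z. coord_influence P {..<m} p (h' z) \<partial>P)"
proof -
  note nn_fst = sigma_finite_measure.nn_integral_fst[OF prob_space_imp_sigma_finite[OF PD.prob_space_axioms]]
  have "(\<lambda>(z, z', D). ((z, D), z')) \<in> measurable (P \<Otimes>\<^sub>M P \<Otimes>\<^sub>M vecs P m) ((P \<Otimes>\<^sub>M vecs P m) \<Otimes>\<^sub>M P)"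
    by measurable
  from measurable_compose[OF this measurable_replace[OF assms]]
  have m: "(\<lambda>(z, z', D). ennreal ((h' z D - h' z (D(p := z')))\<^sup>2)) \<in> borel_measurable (P \<Otimes>\<^sub>M P \<Otimes>\<^sub>M vecs P m)"
    by (simp add: case_prod_beta')
  have "(\<integral>\<^sup>+(z, z', D). ennreal ((h' z D - h' z (D(p := z')))\<^sup>2) \<partial>(P \<Otimes>\<^sub>M P \<Otimes>\<^sub>M vecs P m))
     = (\<integral>\<^sup>+z. \<integral>\<^sup>+(z', D). ennreal ((h' z D - h' z (D(p := z')))\<^sup>2) \<partial>(P \<Otimes>\<^sub>M vecs P m) \<partial>P)"
    by (subst nn_fst[OF m, symmetric]) simp
  also have "\<dots> = (\<integral>\<^sup>+z. coord_influence P {..<m} p (h' z) \<partial>P)"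
  proof (rule nn_integral_cong)
    fix z assume z: "z \<in> space P"
    have mz: "(\<lambda>(z', D). ennreal ((h' z D - h' z (D(p := z')))\<^sup>2)) \<in> borel_measurable (P \<Otimes>\<^sub>M vecs P m)"
      using measurable_Pair2[OF m z] by simp
    show "(\<integral>\<^sup>+(z', D). ennreal ((h' z D - h' z (D(p := z')))\<^sup>2) \<partial>(P \<Otimes>\<^sub>M vecs P m))
        = coord_influence P {..<m} p (h' z)"
      using PD.nn_integral_snd[OF mz] by (simp add: coord_influence_def)
  qed
  finally show ?thesis .
qed

text \<open>The factor \<open>m\<close> cancels the averaging in \<open>ms_stability\<close>; at
  \<open>m = 0\<close> the sum is empty and the right-hand side has the factor 0.\<close>

lemma total_influence_eq:
  "(\<Sum>p<m. \<integral>\<^sup>+z. coord_influence P {..<m} p (h' z) \<partial>P) = of_nat m * loss_stability P m h"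
proof (cases "m = 0")
  case False
  then have "of_nat m * (t / of_nat m) = t" for t :: ennreal
    unfolding ennreal_times_divide by (subst mult.commute) (rule ennreal_mult_divide_eq, auto)
  then show ?thesis
    by (simp add: loss_stability_def ms_stability_def influence_eq)
qed simp

section \<open>A single summand as a function of the sample\<close>

context
  fixes J :: "nat set" and B :: "nat list" and i :: nat
  assumes finJ: "finite J" and B: "distinct B" "set B \<subseteq> J" "i \<in> J" "i \<notin> set B" and len: "length B = m"
begin

interpretation J: iid_coords P J
  using finJ by unfold_locales auto

abbreviation "W x \<equiv> phi (x i) (\<lambda>l\<in>{..<m}. x (B ! l))"

lemma measurable_coord_subvec:
  "(\<lambda>x. (x i, \<lambda>l\<in>{..<m}. x (B ! l))) \<in> measurable (\<Pi>\<^sub>M i\<in>J. P) (P \<Otimes>\<^sub>M vecs P m)"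
  using B len by (intro measurable_Pair measurable_restrict measurable_component_singleton) (auto dest: nth_mem)

lemma measurable_W: "W \<in> borel_measurable (\<Pi>\<^sub>M i\<in>J. P)"
  using measurable_compose[OF measurable_coord_subvec measurable_phi] by simp

lemma nn_integral_coord_subvec:
  assumes "case_prod f \<in> borel_measurable (P \<Otimes>\<^sub>M vecs P m)"
  shows "(\<integral>\<^sup>+x. f (x i) (\<lambda>l\<in>{..<m}. x (B ! l)) \<partial>(\<Pi>\<^sub>M i\<in>J. P)) = (\<integral>\<^sup>+z. \<integral>\<^sup>+D. f z D \<partial>vecs P m \<partial>P)"
proof -
  have "(\<integral>\<^sup>+x. case_prod f (x i, \<lambda>l\<in>{..<m}. x (B ! l)) \<partial>(\<Pi>\<^sub>M i\<in>J. P))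
     = (\<integral>\<^sup>+q. case_prod f q \<partial>distr (\<Pi>\<^sub>M i\<in>J. P) (P \<Otimes>\<^sub>M vecs P m) (\<lambda>x. (x i, \<lambda>l\<in>{..<m}. x (B ! l))))"
    using assms by (subst nn_integral_distr[OF measurable_coord_subvec]) simp_all
  also have "\<dots> = (\<integral>\<^sup>+q. case_prod f q \<partial>(P \<Otimes>\<^sub>M vecs P m))"
    using J.distr_coord_subvec[OF B] len by simp
  finally show ?thesis
    by (simp add: D.Q.nn_integral_fst[OF assms, symmetric])
qed

text \<open>\<open>i\<close> is not a training index, so varying coordinate \<open>i\<close> moves
  the validation point alone.\<close>

lemma centered_W: "J.centered_at i W"
  unfolding J.centered_at_def
proof
  fix x :: "nat \<Rightarrow> 'z"
  have "(\<lambda>l\<in>{..<m}. (x(i := z)) (B ! l)) = (\<lambda>l\<in>{..<m}. x (B ! l))" for z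
    using B len nth_mem[of _ B] by (intro restrict_ext) auto
  then have "W (x(i := z)) = phi z (\<lambda>l\<in>{..<m}. x (B ! l))" for z
    by simp
  then show "coord_mean P i W x = 0"
    by (simp only: coord_mean_def integral_phi_fst)
qed

text \<open>Efron-Stein in the training vector for each fixed validation point \<open>z\<close>,
  with \<open>psi z\<close> as the mean of \<open>h' z\<close>.\<close>

lemma nn_integral_W_square:
  "2 * (\<integral>\<^sup>+x. ennreal ((W x)\<^sup>2) \<partial>(\<Pi>\<^sub>M i\<in>J. P)) \<le> of_nat m * loss_stability P m h"
proof -
  have meas: "(\<lambda>(z, D). ennreal ((phi z D)\<^sup>2)) \<in> borel_measurable (P \<Otimes>\<^sub>M vecs P m)"
    using measurable_phi by (simp add: case_prod_beta')
  have "2 * (\<integral>\<^sup>+x. ennreal ((W x)\<^sup>2) \<partial>(\<Pi>\<^sub>M i\<in>J. P)) = 2 * (\<integral>\<^sup>+z. \<integral>\<^sup>+D. ennreal ((phi z D)\<^sup>2) \<partial>vecs P m \<partial>P)"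
    using nn_integral_coord_subvec[OF meas] by simp
  also have "\<dots> = (\<integral>\<^sup>+z. 2 * (\<integral>\<^sup>+D. ennreal ((phi z D)\<^sup>2) \<partial>vecs P m) \<partial>P)"
    using D.Q.borel_measurable_nn_integral_fst[OF meas] by (intro nn_integral_cmult[symmetric]) simp
  also have "\<dots> \<le> (\<integral>\<^sup>+z. (\<Sum>p<m. coord_influence P {..<m} p (h' z)) \<partial>P)"
    unfolding phi_def psi_def
    by (intro nn_integral_mono Efron_Stein prob_space_axioms measurable_h'_snd) auto
  also have "\<dots> = (\<Sum>p<m. \<integral>\<^sup>+z. coord_influence P {..<m} p (h' z) \<partial>P)"
  proof (rule nn_integral_sum)
    fix p assume "p \<in> {..<m}"
    then show "(\<lambda>z. coord_influence P {..<m} p (h' z)) \<in> borel_measurable P"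
      unfolding coord_influence_def
      using D.Q.borel_measurable_nn_integral_fst[OF measurable_influence[of p]] by simp
  qed
  also have "\<dots> = of_nat m * loss_stability P m h"
    by (rule total_influence_eq)
  finally show ?thesis .
qed

text \<open>As \<open>B\<close> is distinct, resampling coordinate \<open>B ! p\<close> replaces
  exactly position \<open>p\<close> of the training vector; \<open>psi\<close> cancels in the
  difference.\<close>

lemma coord_influence_W:
  assumes p: "p < m"
  shows "coord_influence P J (B ! p) W = (\<integral>\<^sup>+z. coord_influence P {..<m} p (h' z) \<partial>P)"
proof -
  have "B ! p \<noteq> i" using B len p by (auto dest: nth_mem)
  then have "W (x(B ! p := z)) = phi (x i) ((\<lambda>l\<in>{..<m}. x (B ! l))(p := z))" for x z
  proof -
    have "(\<lambda>l\<in>{..<m}. (x(B ! p := z)) (B ! l)) = (\<lambda>l\<in>{..<m}. x (B ! l))(p := z)"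
      using B len p by (auto simp: fun_eq_iff restrict_def nth_eq_iff_index_eq)
    then show ?thesis
      using \<open>B ! p \<noteq> i\<close> by simp
  qed
  then have "coord_influence P J (B ! p) W
      = (\<integral>\<^sup>+x. (\<lambda>z D. \<integral>\<^sup>+z'. ennreal ((h' z D - h' z (D(p := z')))\<^sup>2) \<partial>P) (x i) (\<lambda>l\<in>{..<m}. x (B ! l))
          \<partial>(\<Pi>\<^sub>M i\<in>J. P))"
    by (simp add: coord_influence_def phi_def)
  also have "\<dots> = (\<integral>\<^sup>+z. \<integral>\<^sup>+D. \<integral>\<^sup>+z'. ennreal ((h' z D - h' z (D(p := z')))\<^sup>2) \<partial>P \<partial>vecs P m \<partial>P)"
    by (rule nn_integral_coord_subvec[OF measurable_influence[OF p]])
  finally show ?thesis by (simp add: coord_influence_def)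
qed

text \<open>Coordinates outside \<open>B\<close> and different from \<open>i\<close> do not enter
  \<open>W\<close>; those in \<open>B\<close> correspond to the training positions.\<close>

lemma sum_coord_influence_W:
  "(\<Sum>l\<in>J - {i}. coord_influence P J l W) = of_nat m * loss_stability P m h"
proof -
  have "(\<Sum>l\<in>J - {i}. coord_influence P J l W) = (\<Sum>l\<in>set B. coord_influence P J l W)"
  proof (rule sum.mono_neutral_right)
    show "\<forall>l\<in>J - {i} - set B. coord_influence P J l W = 0"
    proof
      fix l assume l: "l \<in> J - {i} - set B"
      have W_upd: "W (x(l := z)) = W x" for x z
      proof -
        have "(\<lambda>p\<in>{..<m}. (x(l := z)) (B ! p)) = (\<lambda>p\<in>{..<m}. x (B ! p))"
          using l len nth_mem[of _ B] by (intro restrict_ext) auto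
        with l show ?thesis by simp
      qed
      show "coord_influence P J l W = 0"
        unfolding coord_influence_def W_upd by simp
    qed
  qed (use finJ B in auto)
  also have "set B = (!) B ` {..<m}"
    using len by (auto simp: set_conv_nth)
  also have "(\<Sum>l\<in>(!) B ` {..<m}. coord_influence P J l W) = (\<Sum>p<m. coord_influence P J (B ! p) W)"
    using B len by (subst sum.reindex) (auto simp: inj_on_def nth_eq_iff_index_eq)
  also have "\<dots> = of_nat m * loss_stability P m h"
    by (simp add: coord_influence_W total_influence_eq)
  finally show ?thesis .
qed

end

text \<open>\<open>nn_second_moment_sum_le\<close> with \<open>a\<close> equal to \<open>m\<close>
  times the loss stability, which bounds the diagonal by Efron-Stein and equals the total
  influence.\<close>

lemma second_moment_le:
  fixes c :: "'k \<Rightarrow> nat" and B :: "'k \<Rightarrow> nat list"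
  assumes "finite J" "finite K" "inj_on c K"
    and "\<And>\<kappa>. \<kappa> \<in> K \<Longrightarrow> distinct (B \<kappa>) \<and> set (B \<kappa>) \<subseteq> J \<and> c \<kappa> \<in> J \<and> c \<kappa> \<notin> set (B \<kappa>) \<and> length (B \<kappa>) = m"
  shows "(\<integral>\<^sup>+x. ennreal ((\<Sum>\<kappa>\<in>K. phi (x (c \<kappa>)) (\<lambda>l\<in>{..<m}. x (B \<kappa> ! l)))\<^sup>2) \<partial>(\<Pi>\<^sub>M i\<in>J. P))
    \<le> of_nat (card K) * (of_nat m * loss_stability P m h)"
proof -
  interpret J: iid_coords P J
    using assms(1) by unfold_locales auto
  note B = assms(4)[THEN conjunct1] assms(4)[THEN conjunct2, THEN conjunct1]
    assms(4)[THEN conjunct2, THEN conjunct2, THEN conjunct1]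
    assms(4)[THEN conjunct2, THEN conjunct2, THEN conjunct2, THEN conjunct1]
    assms(4)[THEN conjunct2, THEN conjunct2, THEN conjunct2, THEN conjunct2]
  show ?thesis
  proof (rule J.nn_second_moment_sum_le[OF assms(2,3)])
    show "c ` K \<subseteq> J"
      using B(3) by auto
  qed (simp_all add: B centered_W[OF assms(1)] measurable_W[OF assms(1)] nn_integral_W_square[OF assms(1)]
      sum_coord_influence_W[OF assms(1)])
qed

end

section \<open>Cross-validation on an i.i.d. sample\<close>

locale kfold_sample = prob_space M for M :: "'a measure" +
  fixes N :: "'z measure" and Z :: "nat \<Rightarrow> 'a \<Rightarrow> 'z" and n k :: nat
    and B B' :: "nat \<Rightarrow> nat list" and h :: "'z \<Rightarrow> (nat \<Rightarrow> 'z) \<Rightarrow> real" and m :: nat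
  assumes Z0: "Z 0 \<in> measurable M N"
    and indep: "indep_vars (\<lambda>_. N) Z {1..}"
    and same_law: "\<And>i. 1 \<le> i \<Longrightarrow> distr M N (Z i) = distr M N (Z 0)"
    and splits: "kfold_splits n k B B'"
    and m: "m = train_size n k"
    and integrable_loss: "integrable (distr M N (Z 0) \<Otimes>\<^sub>M vecs (distr M N (Z 0)) m) (case_prod h)"
begin

abbreviation "P \<equiv> distr M N (Z 0)"

sublocale L: iid_loss P m h
  using prob_space_distr[OF Z0] integrable_loss by (simp add: iid_loss_def iid_loss_axioms_def)

abbreviation "folds \<equiv> Sigma {1..k} (\<lambda>j. set (B' j))"

lemma n_k: "1 \<le> n" "2 \<le> k" "k dvd n"
  using splits by (auto simp: kfold_splits_def)

lemma m_bounds: "0 < m" "m < n"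
proof -
  have "0 < n div k"
    using n_k by (auto elim!: dvdE)
  moreover have "n div k < n"
    using n_k by auto
  ultimately show "0 < m" "m < n"
    by (auto simp: m train_size_def)
qed

lemma split_props:
  assumes "j \<in> {1..k}"
  shows "distinct (B j)" "set (B j) \<subseteq> {1..n}" "length (B j) = m"
  using splits assms by (auto simp: kfold_splits_def m)

lemma fold_props:
  assumes "j \<in> {1..k}" "i \<in> set (B' j)"
  shows "i \<in> {1..n}" "i \<notin> set (B j)"
  using splits assms by (auto simp: kfold_splits_def)

text \<open>No datapoint is validated in two folds, so different summands are centered in different
  coordinates.\<close>

lemma inj_on_folds: "inj_on snd folds"
proof (rule inj_onI)
  fix a b assume "a \<in> folds" "b \<in> folds" and eq: "snd a = snd b"
  then have "fst a \<in> {1..k}" "fst b \<in> {1..k}" "snd a \<in> set (B' (fst a)) \<inter> set (B' (fst b))"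
    by auto
  then have "fst a = fst b"
    using splits unfolding kfold_splits_def disjoint_family_on_def by blast
  with eq show "a = b" by (simp add: prod_eq_iff)
qed

lemma card_folds: "card folds = n"
proof -
  have "snd ` folds = (\<Union>j\<in>{1..k}. set (B' j))"
    by force
  also have "\<dots> = {1..n}"
    using splits by (simp add: kfold_splits_def)
  finally have "card (snd ` folds) = n" by simp
  then show ?thesis
    using card_image[OF inj_on_folds] by simp
qed

lemma measurable_Z: "1 \<le> i \<Longrightarrow> Z i \<in> measurable M N"
  using indep by (auto simp: indep_vars_def2)

text \<open>Restricting to \<open>{1..n}\<close> makes the data one random vector whose law is a
  finite product measure, so that bounds on product spaces transfer.\<close>

definition sample :: "'a \<Rightarrow> nat \<Rightarrow> 'z"
  where "sample \<omega> = (\<lambda>i\<in>{1..n}. Z i \<omega>)"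

lemma measurable_sample: "sample \<in> measurable M (\<Pi>\<^sub>M i\<in>{1..n}. P)"
  unfolding sample_def[abs_def] by (intro measurable_restrict) (use measurable_Z in auto)

lemma distr_sample: "distr M (\<Pi>\<^sub>M i\<in>{1..n}. P) sample = (\<Pi>\<^sub>M i\<in>{1..n}. P)"
proof -
  have "indep_vars (\<lambda>_. N) Z {1..n}"
    by (rule indep_vars_subset[OF indep]) auto
  then have "distr M (\<Pi>\<^sub>M i\<in>{1..n}. N) (\<lambda>\<omega>. \<lambda>i\<in>{1..n}. Z i \<omega>) = (\<Pi>\<^sub>M i\<in>{1..n}. distr M N (Z i))"
    \<comment> \<open>Characterizing independence by the joint law needs a nonempty index set, hence
      \<open>n \<ge> 1\<close>.\<close>
    using n_k(1) measurable_Z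
    by (subst (asm) indep_vars_iff_distr_eq_PiM') auto
  also have "\<dots> = (\<Pi>\<^sub>M i\<in>{1..n}. P)"
    by (rule PiM_cong) (auto simp: same_law)
  finally have "distr M (\<Pi>\<^sub>M i\<in>{1..n}. N) sample = (\<Pi>\<^sub>M i\<in>{1..n}. P)"
    unfolding sample_def[abs_def] .
  moreover have "distr M (\<Pi>\<^sub>M i\<in>{1..n}. P) sample = distr M (\<Pi>\<^sub>M i\<in>{1..n}. N) sample"
    by (intro distr_cong sets_PiM_cong) auto
  ultimately show ?thesis by simp
qed

lemma nth_in_range: "set A \<subseteq> {1..n} \<Longrightarrow> l < length A \<Longrightarrow> A ! l \<in> {1..n}"
  using nth_mem by blast

lemma subvec_sample:
  assumes "set A \<subseteq> {1..n}"
  shows "subvec Z A \<omega> = (\<lambda>l\<in>{..<length A}. sample \<omega> (A ! l))"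
  unfolding subvec_def
proof (rule restrict_ext)
  fix l assume "l \<in> {..<length A}"
  then have "A ! l \<in> {1..n}" by (intro nth_in_range[OF assms]) simp
  then show "Z (A ! l) \<omega> = sample \<omega> (A ! l)" by (simp add: sample_def)
qed

lemma measurable_subvec:
  assumes "set A \<subseteq> {1..n}"
  shows "subvec Z A \<in> measurable M (vecs P (length A))"
proof -
  have "Z (A ! l) \<in> measurable M P" if "l < length A" for l
    using measurable_Z[of "A ! l"] nth_in_range[OF assms that] by simp
  then show ?thesis
    unfolding subvec_def[abs_def] by (intro measurable_restrict) auto
qed

lemma distr_point_subvec:
  assumes "distinct A" "set A \<subseteq> {1..n}" "i \<in> {1..n}" "i \<notin> set A"
  shows "distr M (P \<Otimes>\<^sub>M vecs P (length A)) (\<lambda>\<omega>. (Z i \<omega>, subvec Z A \<omega>)) = P \<Otimes>\<^sub>M vecs P (length A)"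
proof -
  interpret J: iid_coords P "{1..n}" by unfold_locales auto
  let ?g = "\<lambda>x. (x i, \<lambda>l\<in>{..<length A}. x (A ! l))"
  have g: "?g \<in> measurable (\<Pi>\<^sub>M i\<in>{1..n}. P) (P \<Otimes>\<^sub>M vecs P (length A))"
    using assms(3) nth_in_range[OF assms(2)]
    by (intro measurable_Pair measurable_restrict measurable_component_singleton) (simp_all only: lessThan_iff)
  have "(\<lambda>\<omega>. (Z i \<omega>, subvec Z A \<omega>)) = ?g \<circ> sample"
    using assms by (auto simp: subvec_sample sample_def)
  then have "distr M (P \<Otimes>\<^sub>M vecs P (length A)) (\<lambda>\<omega>. (Z i \<omega>, subvec Z A \<omega>))
      = distr (distr M (\<Pi>\<^sub>M i\<in>{1..n}. P) sample) (P \<Otimes>\<^sub>M vecs P (length A)) ?g"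
    by (simp only: distr_distr[OF g measurable_sample])
  then show ?thesis
    by (simp only: distr_sample J.distr_coord_subvec[OF assms])
qed

lemma distr_subvec:
  assumes "distinct A" "set A \<subseteq> {1..n}"
  shows "distr M (vecs P (length A)) (subvec Z A) = vecs P (length A)"
proof -
  let ?g = "\<lambda>x. \<lambda>l\<in>{..<length A}. x (A ! l)"
  have A: "(!) A \<in> {..<length A} \<rightarrow> {1..n}"
    using nth_in_range[OF assms(2)] by blast
  have g: "?g \<in> measurable (\<Pi>\<^sub>M i\<in>{1..n}. P) (vecs P (length A))"
    using A by (intro measurable_restrict measurable_component_singleton) auto
  have "subvec Z A = ?g \<circ> sample"
    using assms by (auto simp: fun_eq_iff subvec_sample)
  then have "distr M (vecs P (length A)) (subvec Z A)
      = distr (distr M (\<Pi>\<^sub>M i\<in>{1..n}. P) sample) (vecs P (length A)) ?g"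
    by (simp only: distr_distr[OF g measurable_sample])
  also have "\<dots> = distr (\<Pi>\<^sub>M i\<in>{1..n}. P) (vecs P (length A)) ?g"
    by (simp only: distr_sample)
  also have "\<dots> = vecs P (length A)"
    using assms(1) A
    by (intro distr_PiM_reindex[where M = "\<lambda>_. P"] L.prob_space_axioms) (auto simp: inj_on_def nth_eq_iff_index_eq)
  finally show ?thesis .
qed

text \<open>The common almost sure value of the sums in both claims, before their scalar
  factors.\<close>

definition fluct :: "'a \<Rightarrow> real"
  where "fluct \<omega> = (\<Sum>j=1..k. \<Sum>i\<in>set (B' j). L.phi (Z i \<omega>) (subvec Z (B j) \<omega>))"

lemma fluct_sample:
  "fluct \<omega> = (\<Sum>\<kappa>\<in>folds. L.phi (sample \<omega> (snd \<kappa>)) (\<lambda>l\<in>{..<m}. sample \<omega> (B (fst \<kappa>) ! l)))"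
proof -
  have "fluct \<omega> = (\<Sum>(j, i)\<in>folds. L.phi (Z i \<omega>) (subvec Z (B j) \<omega>))"
    unfolding fluct_def by (rule sum.Sigma) auto
  also have "\<dots> = (\<Sum>\<kappa>\<in>folds. L.phi (sample \<omega> (snd \<kappa>)) (\<lambda>l\<in>{..<m}. sample \<omega> (B (fst \<kappa>) ! l)))"
  proof (rule sum.cong[OF refl], clarify)
    fix j i assume "j \<in> {1..k}" "i \<in> set (B' j)"
    then show "L.phi (Z i \<omega>) (subvec Z (B j) \<omega>)
        = L.phi (sample \<omega> (snd (j, i))) (\<lambda>l\<in>{..<m}. sample \<omega> (B (fst (j, i)) ! l))"
      using fold_props[of j i] split_props[of j] by (simp add: subvec_sample sample_def)
  qed
  finally show ?thesis .
qed

lemma joint_law: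
  assumes "j \<in> {1..k}" "i \<in> set (B' j)"
  shows "(\<lambda>\<omega>. (Z i \<omega>, subvec Z (B j) \<omega>)) \<in> measurable M (P \<Otimes>\<^sub>M vecs P m)"
    and "distr M (P \<Otimes>\<^sub>M vecs P m) (\<lambda>\<omega>. (Z i \<omega>, subvec Z (B j) \<omega>)) = P \<Otimes>\<^sub>M vecs P m"
  using distr_point_subvec[OF split_props(1,2) fold_props] measurable_subvec[OF split_props(2)]
    measurable_Z[of i] fold_props split_props(3) assms
  by auto

lemma integrable_fluct: "integrable M fluct"
  and integral_fluct: "(\<integral>\<omega>. fluct \<omega> \<partial>M) = 0"
proof -
  have int: "integrable M (\<lambda>\<omega>. L.phi (Z i \<omega>) (subvec Z (B j) \<omega>))"
    and 0: "(\<integral>\<omega>. L.phi (Z i \<omega>) (subvec Z (B j) \<omega>) \<partial>M) = 0"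
    if "j \<in> {1..k}" "i \<in> set (B' j)" for j i
    using integrable_distr[OF joint_law(1)[OF that], of "case_prod L.phi"] L.integrable_phi
      integral_distr[OF joint_law(1)[OF that], of "case_prod L.phi"] L.integral_phi joint_law(2)[OF that]
    by simp_all
  show "integrable M fluct"
    unfolding fluct_def[abs_def] using int by auto
  show "(\<integral>\<omega>. fluct \<omega> \<partial>M) = 0"
    unfolding fluct_def using int 0 by (simp add: Bochner_Integration.integral_sum)
qed

text \<open>The product-space bound is pulled back along \<open>sample\<close>; there are
  \<open>n\<close> summands because the folds partition the data.\<close>

lemma nn_integral_fluct_square:
  "(\<integral>\<^sup>+\<omega>. ennreal ((fluct \<omega>)\<^sup>2) \<partial>M) \<le> of_nat n * (of_nat m * loss_stability P m h)"
proof -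
  let ?G = "\<lambda>x. \<Sum>\<kappa>\<in>folds. L.phi (x (snd \<kappa>)) (\<lambda>l\<in>{..<m}. x (B (fst \<kappa>) ! l))"
  have side: "distinct (B (fst \<kappa>)) \<and> set (B (fst \<kappa>)) \<subseteq> {1..n} \<and> snd \<kappa> \<in> {1..n} \<and> snd \<kappa> \<notin> set (B (fst \<kappa>))
      \<and> length (B (fst \<kappa>)) = m" if "\<kappa> \<in> folds" for \<kappa>
  proof -
    have "fst \<kappa> \<in> {1..k}" "snd \<kappa> \<in> set (B' (fst \<kappa>))" using that by auto
    then show ?thesis using split_props fold_props by blast
  qed
  have G: "?G \<in> borel_measurable (\<Pi>\<^sub>M i\<in>{1..n}. P)"
    using side by (intro borel_measurable_sum L.measurable_W) auto
  have "(\<integral>\<^sup>+\<omega>. ennreal ((fluct \<omega>)\<^sup>2) \<partial>M) = (\<integral>\<^sup>+\<omega>. ennreal ((?G (sample \<omega>))\<^sup>2) \<partial>M)"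
    by (simp only: fluct_sample)
  also have "\<dots> = (\<integral>\<^sup>+x. ennreal ((?G x)\<^sup>2) \<partial>distr M (\<Pi>\<^sub>M i\<in>{1..n}. P) sample)"
    using G by (subst nn_integral_distr[OF measurable_sample]) auto
  also have "\<dots> \<le> of_nat (card folds) * (of_nat m * loss_stability P m h)"
    unfolding distr_sample by (rule L.second_moment_le[OF _ _ inj_on_folds side]) auto
  finally show ?thesis by (simp only: card_folds)
qed

section \<open>Conditional expectations and the common fluctuation\<close>

lemma AE_cond_exp_point:
  assumes "j \<in> {1..k}" "i \<in> set (B' j)"
  shows "AE \<omega> in M. centered_loss P h (Z i \<omega>) (subvec Z (B j) \<omega>)
      - cond_exp_given M N (Z i) (\<lambda>\<omega>. centered_loss P h (Z i \<omega>) (subvec Z (B j) \<omega>)) \<omega>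
    = L.phi (Z i \<omega>) (subvec Z (B j) \<omega>)"
proof -
  have Zi: "Z i \<in> measurable M P" and D: "subvec Z (B j) \<in> measurable M (vecs P m)"
    using measurable_Z[of i] fold_props[OF assms] measurable_subvec[OF split_props(2)[OF assms(1)]]
      split_props(3)[OF assms(1)] by auto
  \<comment> \<open>Conditioning on the validation point integrates out the independent training
    vector, which gives \<open>psi (Z i \<omega>)\<close>.\<close>
  have "AE \<omega> in M. cond_exp_given M P (Z i) (\<lambda>\<omega>. centered_loss P h (Z i \<omega>) (subvec Z (B j) \<omega>)) \<omega>
      = (\<integral>D. centered_loss P h (Z i \<omega>) D \<partial>vecs P m)"
    by (rule cond_exp_given_independent[OF L.prob_space_axioms L.D.Q.prob_space_axioms Zi D
          joint_law(2)[OF assms] L.integrable_h'])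
  then show ?thesis
    by (simp add: L.phi_def L.psi_def cond_exp_given_cong[of N P])
qed

text \<open>Vectors of \<open>m\<close> distinct datapoints all have the same law, so the first
  \<open>m\<close> points represent a generic training vector. Sections of \<open>h\<close> are
  known to be measurable at points of \<open>space P\<close>.\<close>

lemma mean_loss_eq:
  assumes "z \<in> space P"
  shows "mean_loss M Z m h z = (\<integral>D. h z D \<partial>vecs P m)"
proof -
  have h: "h z \<in> borel_measurable (vecs P m)"
    using measurable_Pair2[OF L.measurable_h assms] by simp
  have A: "distinct [1..<Suc m]" "set [1..<Suc m] \<subseteq> {1..n}" "length [1..<Suc m] = m"
    using m_bounds by (auto simp del: upt_Suc)
  have "(\<integral>D. h z D \<partial>distr M (vecs P m) (subvec Z [1..<Suc m])) = (\<integral>\<omega>. h z (subvec Z [1..<Suc m] \<omega>) \<partial>M)"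
    using measurable_subvec[OF A(2)] h unfolding A(3) by (rule integral_distr)
  then show ?thesis
    using distr_subvec[OF A(1,2)] unfolding A(3) mean_loss_def by simp
qed

text \<open>Conditioning on the training vector integrates out the validation point and turns
  \<open>h\<close> into \<open>h'\<close>; the centered mean loss is \<open>psi\<close> almost
  surely.\<close>

lemma AE_cond_exp_train:
  assumes "j \<in> {1..k}" "i \<in> set (B' j)"
  shows "AE \<omega> in M. h (Z i \<omega>) (subvec Z (B j) \<omega>)
      - cond_exp_given M (vecs N m) (subvec Z (B j)) (\<lambda>\<omega>. h (Z i \<omega>) (subvec Z (B j) \<omega>)) \<omega>
      - (mean_loss M Z m h (Z i \<omega>) - (\<integral>\<omega>'. mean_loss M Z m h (Z i \<omega>') \<partial>M))
    = L.phi (Z i \<omega>) (subvec Z (B j) \<omega>)"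
proof -
  have i: "1 \<le> i" using fold_props[OF assms] by simp
  have Zi: "Z i \<in> measurable M P" and D: "subvec Z (B j) \<in> measurable M (vecs P m)"
    using measurable_Z[of i] i measurable_subvec[OF split_props(2)[OF assms(1)]]
      split_props(3)[OF assms(1)] by auto
  have Pi: "distr M P (Z i) = P"
    using same_law[OF i] by (subst distr_cong[of M M P N "Z i" "Z i"]) auto
  have DP: "pair_sigma_finite (vecs P m) P"
    by (intro pair_sigma_finite.intro prob_space_imp_sigma_finite L.D.Q.prob_space_axioms L.prob_space_axioms)
  \<comment> \<open>\<open>cond_exp_given_independent\<close> conditions on the first component,
    hence the swap.\<close>
  have law: "distr M (vecs P m \<Otimes>\<^sub>M P) (\<lambda>\<omega>. (subvec Z (B j) \<omega>, Z i \<omega>)) = vecs P m \<Otimes>\<^sub>M P"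
  proof -
    have "distr M (vecs P m \<Otimes>\<^sub>M P) (\<lambda>\<omega>. (subvec Z (B j) \<omega>, Z i \<omega>))
        = distr (distr M (P \<Otimes>\<^sub>M vecs P m) (\<lambda>\<omega>. (Z i \<omega>, subvec Z (B j) \<omega>))) (vecs P m \<Otimes>\<^sub>M P) (\<lambda>(x, y). (y, x))"
      by (subst distr_distr[OF measurable_pair_swap' joint_law(1)[OF assms]]) (simp add: comp_def)
    then show ?thesis
      by (simp add: joint_law(2)[OF assms] pair_sigma_finite.distr_pair_swap[OF DP, symmetric])
  qed
  have int: "integrable (vecs P m \<Otimes>\<^sub>M P) (case_prod (\<lambda>D z. h z D))"
    using L.PD.integrable_product_swap[OF integrable_loss] by (simp add: case_prod_beta')
  have "AE \<omega> in M. cond_exp_given M (vecs P m) (subvec Z (B j)) (\<lambda>\<omega>. h (Z i \<omega>) (subvec Z (B j) \<omega>)) \<omega>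
      = (\<integral>z. h z (subvec Z (B j) \<omega>) \<partial>P)"
    by (rule cond_exp_given_independent[OF L.D.Q.prob_space_axioms L.prob_space_axioms D Zi law int])
  moreover have "cond_exp_given M (vecs N m) = cond_exp_given M (vecs P m)"
    by (intro ext cond_exp_given_cong sets_PiM_cong) auto
  ultimately have cond: "AE \<omega> in M. cond_exp_given M (vecs N m) (subvec Z (B j))
      (\<lambda>\<omega>. h (Z i \<omega>) (subvec Z (B j) \<omega>)) \<omega> = (\<integral>z. h z (subvec Z (B j) \<omega>) \<partial>P)"
    by simp
  \<comment> \<open>The overall mean of the loss: by Fubini the expectation of the mean loss, and
    also the constant by which \<open>psi\<close> falls short of it.\<close>
  define e where "e = (\<integral>D. \<integral>z. h z D \<partial>P \<partial>vecs P m)"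
  have mean_meas: "(\<lambda>z. \<integral>D. h z D \<partial>vecs P m) \<in> borel_measurable P"
    using L.PD.integrable_fst'[OF integrable_loss] by auto
  have "(\<integral>\<omega>. mean_loss M Z m h (Z i \<omega>) \<partial>M) = (\<integral>\<omega>. (\<integral>D. h (Z i \<omega>) D \<partial>vecs P m) \<partial>M)"
    using measurable_space[OF Zi] by (intro Bochner_Integration.integral_cong) (auto simp: mean_loss_eq)
  also have "\<dots> = (\<integral>z. (\<integral>D. h z D \<partial>vecs P m) \<partial>distr M P (Z i))"
    by (rule integral_distr[OF Zi mean_meas, symmetric])
  also have "\<dots> = e"
    unfolding Pi e_def using L.PD.Fubini_integral[of h] integrable_loss by simp
  finally have mean: "(\<integral>\<omega>. mean_loss M Z m h (Z i \<omega>) \<partial>M) = e" .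
  \<comment> \<open>Splitting the integral in \<open>psi z\<close> needs an integrable section,
    guaranteed only for almost every \<open>z\<close>; the statement is then pulled back along
    \<open>Z i\<close>.\<close>
  have "AE z in P. integrable (vecs P m) (h z)"
    using L.PD.AE_integrable_fst'[OF integrable_loss] by simp
  then have "AE z in P. L.psi z = (\<integral>D. h z D \<partial>vecs P m) - e"
  proof eventually_elim
    case (elim z)
    have "integrable (vecs P m) (\<lambda>D. \<integral>z. h z D \<partial>P)"
      using L.PD.integrable_snd[of "\<lambda>z D. h z D"] integrable_loss by simp
    with elim show ?case
      by (simp add: L.psi_def centered_loss_def e_def)
  qed
  then have "AE z in distr M P (Z i). L.psi z = (\<integral>D. h z D \<partial>vecs P m) - e"
    by (simp only: Pi)
  then have "AE \<omega> in M. L.psi (Z i \<omega>) = (\<integral>D. h (Z i \<omega>) D \<partial>vecs P m) - e"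
    by (rule AE_distrD[OF Zi])
  with cond AE_space show ?thesis
  proof eventually_elim
    case (elim \<omega>)
    have "Z i \<omega> \<in> space P"
      using measurable_space[OF Zi elim(2)] .
    with elim show ?case
      unfolding mean by (simp add: L.phi_def centered_loss_def mean_loss_eq)
  qed
qed

lemma AE_sum_folds:
  assumes "\<And>j i. j \<in> {1..k} \<Longrightarrow> i \<in> set (B' j) \<Longrightarrow> AE \<omega> in M. X j i \<omega> = L.phi (Z i \<omega>) (subvec Z (B j) \<omega>)"
  shows "AE \<omega> in M. (\<Sum>j=1..k. \<Sum>i\<in>set (B' j). X j i \<omega>) = fluct \<omega>"
proof -
  have "AE \<omega> in M. \<forall>j\<in>{1..k}. \<forall>i\<in>set (B' j). X j i \<omega> = L.phi (Z i \<omega>) (subvec Z (B j) \<omega>)"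
    using assms by (simp add: AE_finite_all)
  then show ?thesis
    by eventually_elim (simp add: fluct_def)
qed

section \<open>Bounds for the two normalized sums\<close>

lemma nn_integral_scaled_fluct_square:
  "(\<integral>\<^sup>+\<omega>. ennreal ((c * fluct \<omega>)\<^sup>2) \<partial>M) \<le> ennreal (c\<^sup>2 * real n * real m) * loss_stability P m h"
proof -
  have [measurable]: "fluct \<in> borel_measurable M"
    using integrable_fluct by auto
  have "(\<integral>\<^sup>+\<omega>. ennreal ((c * fluct \<omega>)\<^sup>2) \<partial>M) = ennreal (c\<^sup>2) * (\<integral>\<^sup>+\<omega>. ennreal ((fluct \<omega>)\<^sup>2) \<partial>M)"
    by (simp add: power_mult_distrib ennreal_mult nn_integral_cmult)
  also have "\<dots> \<le> ennreal (c\<^sup>2) * (of_nat n * (of_nat m * loss_stability P m h))"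
    by (rule mult_left_mono[OF nn_integral_fluct_square]) simp
  also have "\<dots> = ennreal (c\<^sup>2 * real n * real m) * loss_stability P m h"
    by (simp add: ennreal_mult ennreal_of_nat_eq_real_of_nat mult.assoc)
  finally show ?thesis .
qed

text \<open>The normalized sum has mean 0, because it agrees almost surely with a multiple of
  \<open>fluct\<close>; its variance is therefore a second moment.\<close>

lemma evar_le:
  "evar M (\<lambda>\<omega>. 1 / sqrt (real n) *
      (\<Sum>j=1..k. \<Sum>i\<in>set (B' j).
         (centered_loss P h (Z i \<omega>) (subvec Z (B j) \<omega>)
        - cond_exp_given M N (Z i) (\<lambda>\<omega>. centered_loss P h (Z i \<omega>) (subvec Z (B j) \<omega>)) \<omega>)))
    \<le> ennreal (3 / 2 * real n * (1 - 1 / real k)) * loss_stability P m h"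
    (is "evar M ?X \<le> _")
proof -
  have "AE \<omega> in M. (\<Sum>j=1..k. \<Sum>i\<in>set (B' j).
         (centered_loss P h (Z i \<omega>) (subvec Z (B j) \<omega>)
        - cond_exp_given M N (Z i) (\<lambda>\<omega>. centered_loss P h (Z i \<omega>) (subvec Z (B j) \<omega>)) \<omega>)) = fluct \<omega>"
    by (rule AE_sum_folds, rule AE_cond_exp_point)
  then have ae: "AE \<omega> in M. ?X \<omega> = 1 / sqrt (real n) * fluct \<omega>"
    by eventually_elim simp
  \<comment> \<open>Passing from almost sure equality to equality of Bochner integrals requires
    measurability of both functions.\<close>
  have "?X \<in> borel_measurable M"
    unfolding cond_exp_given_def
  proof (intro borel_measurable_times borel_measurable_const borel_measurable_sum borel_measurable_diff
      borel_measurable_cond_exp2)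
    fix j i assume "j \<in> {1..k}" "i \<in> set (B' j)"
    from measurable_compose[OF joint_law(1)[OF this] L.measurable_h']
    show "(\<lambda>\<omega>. centered_loss P h (Z i \<omega>) (subvec Z (B j) \<omega>)) \<in> borel_measurable M" by simp
  qed
  then have "(\<integral>\<omega>. ?X \<omega> \<partial>M) = (\<integral>\<omega>. 1 / sqrt (real n) * fluct \<omega> \<partial>M)"
    using integrable_fluct by (intro integral_cong_AE ae) auto
  also have "\<dots> = 0"
    by (simp add: integral_fluct)
  finally have "evar M ?X = (\<integral>\<^sup>+\<omega>. ennreal ((1 / sqrt (real n) * fluct \<omega>)\<^sup>2) \<partial>M)"
    unfolding evar_def using ae by (intro nn_integral_cong_AE) auto
  also have "\<dots> \<le> ennreal ((1 / sqrt (real n))\<^sup>2 * real n * real m) * loss_stability P m h"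
    by (rule nn_integral_scaled_fluct_square)
  also have "(1 / sqrt (real n))\<^sup>2 * real n * real m = real m"
    using n_k(1) by (simp add: power_divide)
  \<comment> \<open>\<open>m\<close> equals \<open>n (1 - 1 / k)\<close>, and enlarging it by the
    factor \<open>3 / 2\<close> gives the stated form.\<close>
  also have "ennreal (real m) \<le> ennreal (3 / 2 * real n * (1 - 1 / real k))"
    using real_train_size[OF n_k(3)] m by (intro ennreal_leI) simp
  finally show ?thesis
    by (simp add: mult_right_mono)
qed

text \<open>Bounding \<open>m\<close> by \<open>n\<close> leaves the stability divided by
  \<open>s^2 / n\<close>, the ratio in the little-o hypothesis.\<close>

lemma nn_integral_normalized_square_le:
  "(\<integral>\<^sup>+\<omega>. ennreal ((1 / (s * sqrt (real n)) *
      (\<Sum>j=1..k. \<Sum>i\<in>set (B' j).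
         (h (Z i \<omega>) (subvec Z (B j) \<omega>)
        - cond_exp_given M (vecs N m) (subvec Z (B j)) (\<lambda>\<omega>. h (Z i \<omega>) (subvec Z (B j) \<omega>)) \<omega>
        - (mean_loss M Z m h (Z i \<omega>) - (\<integral>\<omega>'. mean_loss M Z m h (Z i \<omega>') \<partial>M)))))\<^sup>2) \<partial>M)
    \<le> ennreal (real n / s\<^sup>2) * loss_stability P m h" (is "?L \<le> _")
proof -
  have "AE \<omega> in M. (\<Sum>j=1..k. \<Sum>i\<in>set (B' j).
         (h (Z i \<omega>) (subvec Z (B j) \<omega>)
        - cond_exp_given M (vecs N m) (subvec Z (B j)) (\<lambda>\<omega>. h (Z i \<omega>) (subvec Z (B j) \<omega>)) \<omega>
        - (mean_loss M Z m h (Z i \<omega>) - (\<integral>\<omega>'. mean_loss M Z m h (Z i \<omega>') \<partial>M)))) = fluct \<omega>"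
    by (rule AE_sum_folds, rule AE_cond_exp_train)
  then have "?L = (\<integral>\<^sup>+\<omega>. ennreal ((1 / (s * sqrt (real n)) * fluct \<omega>)\<^sup>2) \<partial>M)"
    by (intro nn_integral_cong_AE) (elim eventually_mono, simp only:)
  also have "\<dots> \<le> ennreal ((1 / (s * sqrt (real n)))\<^sup>2 * real n * real m) * loss_stability P m h"
    by (rule nn_integral_scaled_fluct_square)
  also have "(1 / (s * sqrt (real n)))\<^sup>2 * real n * real m = real m / s\<^sup>2"
    using n_k(1) by (simp add: power_divide power_mult_distrib)
  also have "ennreal (real m / s\<^sup>2) \<le> ennreal (real n / s\<^sup>2)"
    using m_bounds by (intro ennreal_leI divide_right_mono) auto
  finally show ?thesis
    by (simp add: mult_right_mono)
qed

end

text \<open>Convergence in L2 is phrased as the second moment tending to 0 along the admissible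
  sizes. Eventual finiteness of the stability accompanies the little-o condition because
  \<open>enn2real\<close> maps infinity to 0. Each size in \<open>S\<close> yields an instance of
  \<open>kfold_sample\<close>.\<close>

theorem theorem2:
  fixes M :: "'a measure" and N :: "'z measure" and Z :: "nat \<Rightarrow> 'a \<Rightarrow> 'z"
    and S :: "nat set" and k :: "nat \<Rightarrow> nat" and B B' :: "nat \<Rightarrow> nat \<Rightarrow> nat list"
    and h :: "nat \<Rightarrow> 'z \<Rightarrow> (nat \<Rightarrow> 'z) \<Rightarrow> real" and m :: "nat \<Rightarrow> nat"
  assumes "prob_space M"
    and "Z 0 \<in> measurable M N"
    and "prob_space.indep_vars M (\<lambda>_. N) Z {1..}"
    and "\<And>i. 1 \<le> i \<Longrightarrow> distr M N (Z i) = distr M N (Z 0)"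
    and "\<And>n. n \<in> S \<Longrightarrow> kfold_splits n (k n) (B n) (B' n)"
    and "\<And>n. m n = train_size n (k n)"
    and "\<And>n. n \<in> S \<Longrightarrow> case_prod (h n) \<in> borel_measurable (N \<Otimes>\<^sub>M vecs N (m n))"
    and "\<And>n. n \<in> S \<Longrightarrow>
      integrable (distr M N (Z 0) \<Otimes>\<^sub>M vecs (distr M N (Z 0)) (m n)) (case_prod (h n))"
  shows
    "(\<forall>n\<in>S.
        evar M (\<lambda>\<omega>. 1 / sqrt (real n) *
          (\<Sum>j=1..k n. \<Sum>i\<in>set (B' n j).
             (centered_loss (distr M N (Z 0)) (h n) (Z i \<omega>) (subvec Z (B n j) \<omega>)
            - cond_exp_given M N (Z i)
                (\<lambda>\<omega>. centered_loss (distr M N (Z 0)) (h n) (Z i \<omega>) (subvec Z (B n j) \<omega>)) \<omega>)))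
        \<le> ennreal (3 / 2 * real n * (1 - 1 / real (k n)))
            * loss_stability (distr M N (Z 0)) (m n) (h n))
     \<and>
     (\<forall>\<sigma> :: nat \<Rightarrow> real.
        (\<forall>n\<in>S. 0 < \<sigma> n \<and>
           ennreal ((\<sigma> n)\<^sup>2) = evar M (\<lambda>\<omega>. mean_loss M Z (m n) (h n) (Z 0 \<omega>)))
        \<longrightarrow> (\<forall>\<^sub>F n in sizes_to_infinity S.
               loss_stability (distr M N (Z 0)) (m n) (h n) < \<infinity>)
        \<longrightarrow> (\<lambda>n. enn2real (loss_stability (distr M N (Z 0)) (m n) (h n)))
              \<in> o[sizes_to_infinity S](\<lambda>n. (\<sigma> n)\<^sup>2 / real n)
        \<longrightarrow> ((\<lambda>n. \<integral>\<^sup>+\<omega>. ennreal ((1 / (\<sigma> n * sqrt (real n)) *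
               (\<Sum>j=1..k n. \<Sum>i\<in>set (B' n j).
                  (h n (Z i \<omega>) (subvec Z (B n j) \<omega>)
                 - cond_exp_given M (vecs N (m n)) (subvec Z (B n j))
                     (\<lambda>\<omega>. h n (Z i \<omega>) (subvec Z (B n j) \<omega>)) \<omega>
                 - (mean_loss M Z (m n) (h n) (Z i \<omega>)
                     - (\<integral>\<omega>'. mean_loss M Z (m n) (h n) (Z i \<omega>') \<partial>M)))))\<^sup>2) \<partial>M)
              \<longlongrightarrow> 0) (sizes_to_infinity S))"
proof -
  let ?P = "distr M N (Z 0)"
  have sample: "kfold_sample M N Z n (k n) (B n) (B' n) (h n) (m n)" if "n \<in> S" for n
    using that assms by (simp add: kfold_sample_def kfold_sample_axioms_def)
  let ?\<gamma> = "\<lambda>n. loss_stability ?P (m n) (h n)"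
  show ?thesis
  proof (intro conjI ballI allI impI)
    fix n assume "n \<in> S"
    then interpret kfold_sample M N Z n "k n" "B n" "B' n" "h n" "m n" by (rule sample)
    show "evar M (\<lambda>\<omega>. 1 / sqrt (real n) *
          (\<Sum>j=1..k n. \<Sum>i\<in>set (B' n j).
             (centered_loss ?P (h n) (Z i \<omega>) (subvec Z (B n j) \<omega>)
            - cond_exp_given M N (Z i)
                (\<lambda>\<omega>. centered_loss ?P (h n) (Z i \<omega>) (subvec Z (B n j) \<omega>)) \<omega>)))
        \<le> ennreal (3 / 2 * real n * (1 - 1 / real (k n))) * ?\<gamma> n"
      by (rule evar_le)
  next
    fix \<sigma> :: "nat \<Rightarrow> real"
    let ?F = "sizes_to_infinity S"
    assume finite: "\<forall>\<^sub>F n in ?F. ?\<gamma> n < \<infinity>"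
      and small: "(\<lambda>n. enn2real (?\<gamma> n)) \<in> o[?F](\<lambda>n. (\<sigma> n)\<^sup>2 / real n)"
    let ?I = "\<lambda>n. \<integral>\<^sup>+\<omega>. ennreal ((1 / (\<sigma> n * sqrt (real n)) *
               (\<Sum>j=1..k n. \<Sum>i\<in>set (B' n j).
                  (h n (Z i \<omega>) (subvec Z (B n j) \<omega>)
                 - cond_exp_given M (vecs N (m n)) (subvec Z (B n j))
                     (\<lambda>\<omega>. h n (Z i \<omega>) (subvec Z (B n j) \<omega>)) \<omega>
                 - (mean_loss M Z (m n) (h n) (Z i \<omega>)
                     - (\<integral>\<omega>'. mean_loss M Z (m n) (h n) (Z i \<omega>') \<partial>M)))))\<^sup>2) \<partial>M"
    have "\<forall>\<^sub>F n in ?F. n \<in> S"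
      by (simp add: eventually_inf_principal)
    with finite have upper: "\<forall>\<^sub>F n in ?F. ?I n \<le> ennreal (enn2real (?\<gamma> n) / ((\<sigma> n)\<^sup>2 / real n))"
    proof eventually_elim
      case (elim n)
      from elim(2) interpret kfold_sample M N Z n "k n" "B n" "B' n" "h n" "m n" by (rule sample)
      have "?I n \<le> ennreal (real n / (\<sigma> n)\<^sup>2) * ?\<gamma> n"
        by (rule nn_integral_normalized_square_le)
      \<comment> \<open>Eventual finiteness enters here and turns the bound into the real quotient
        controlled by \<open>small\<close>.\<close>
      also have "?\<gamma> n = ennreal (enn2real (?\<gamma> n))"
        using elim(1) by simp
      also have "ennreal (real n / (\<sigma> n)\<^sup>2) * ennreal (enn2real (?\<gamma> n))
          = ennreal (enn2real (?\<gamma> n) / ((\<sigma> n)\<^sup>2 / real n))"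
        by (simp add: ennreal_mult[symmetric] mult.commute)
      finally show ?case .
    qed
    have "((\<lambda>n. ennreal (enn2real (?\<gamma> n) / ((\<sigma> n)\<^sup>2 / real n))) \<longlongrightarrow> ennreal 0) ?F"
      by (intro tendsto_ennrealI smalloD_tendsto[OF small])
    then show "(?I \<longlongrightarrow> 0) ?F"
      by (intro tendsto_sandwich[OF _ upper tendsto_const]) simp_all
  qed
qed

end
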